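(* Let $X=\{x_k\}_{k=-\infty}^\infty\subset\mathbb{R}$ be an increasing sequence such that, with $d_k:=x_{k+1}-x_k$, one has $\inf_{k\in\mathbb{Z}}d_k>0$ and $\sup_{k\in\mathbb{Z}}d_k<\infty$. Let $\beta=\{\beta_k\}_{k=-\infty}^\infty\subset\mathbb{R}$ and let $L_{X,\beta}$ be the self-adjoint operator in $L^2(\mathbb{R})$ with $\delta'$-interactions of strengths $\beta_k$ at the points $x_k$. Then $\kappa_-(L_{X,\beta})=\kappa_-(\beta)$, where $\kappa_-(\beta)$ is the number of indices $k\in\mathbb{Z}$ with $\beta_k<0$.
   Context: $W_2^2(\mathbb{R}\setminus X):=\{f\in L^2(\mathbb{R}): f,f'\in AC_{loc}(\mathbb{R}\setminus X),\ f''\in L^2(\mathbb{R})\}$. The operator $L_{X,\beta}$ acts in $L^2(\mathbb{R})$ by $f\mapsto -f''$ (on $\mathbb{R}\setminus X$) on the domain $$\{f\in W_2^2(\mathbb{R}\setminus X): f'(x_k+)=f'(x_k-),\ f(x_k+)-f(x_k-)=\beta_k f'(x_k)\ \text{for all }x_k\in X\};$$ it is known to be self-adjoint. For a self-adjoint operator $T$ in a Hilbert space $\mathfrak{H}$ with spectral measure $E_T$, the number of negative squares is $\kappa_-(T):=\dim E_T(-\infty,0)\mathfrak{H}\in\{0,1,2,\dots\}\cup\{\infty\}$. Both sides of the asserted equality take values in $\{0,1,2,\dots\}\cup\{\infty\}$. *)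

theory Defs
  imports "HOL-Analysis.Analysis" "HOL-Library.Extended_Nat"
begin

section \<open>The complex Hilbert space of square integrable functions on the real line\<close>

definition sq_integrable :: "(real \<Rightarrow> complex) \<Rightarrow> bool" where
  "sq_integrable f \<longleftrightarrow>
     f \<in> borel_measurable lborel \<and> integrable lborel (\<lambda>t. (cmod (f t))\<^sup>2)"

lemma sq_integrable_zero: "sq_integrable (\<lambda>_. 0)"
  by (simp add: sq_integrable_def)

lemma sq_integrable_add:
  assumes "sq_integrable f" "sq_integrable g"
  shows "sq_integrable (\<lambda>t. f t + g t)"
proof -
  have [measurable]: "f \<in> borel_measurable borel" "g \<in> borel_measurable borel"
    using assms by (auto simp: sq_integrable_def)
  have "integrable lborel (\<lambda>t. 2 * (cmod (f t))\<^sup>2 + 2 * (cmod (g t))\<^sup>2)"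
    using assms by (auto simp: sq_integrable_def)
  then have "integrable lborel (\<lambda>t. (cmod (f t + g t))\<^sup>2)"
  proof (rule Bochner_Integration.integrable_bound)
    have "(cmod (a + b))\<^sup>2 \<le> 2 * (cmod a)\<^sup>2 + 2 * (cmod b)\<^sup>2" for a b
    proof -
      have "(cmod (a + b))\<^sup>2 \<le> (cmod a + cmod b)\<^sup>2"
        by (intro power_mono norm_triangle_ineq) auto
      also have "\<dots> \<le> 2 * (cmod a)\<^sup>2 + 2 * (cmod b)\<^sup>2"
        using sum_squares_bound[of "cmod a" "cmod b"] by (simp add: power2_sum)
      finally show ?thesis .
    qed
    then show "AE t in lborel. norm ((cmod (f t + g t))\<^sup>2)
        \<le> norm (2 * (cmod (f t))\<^sup>2 + 2 * (cmod (g t))\<^sup>2)"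
      by (intro AE_I2) simp
  qed measurable
  then show ?thesis by (simp add: sq_integrable_def)
qed

lemma sq_integrable_mult:
  assumes "sq_integrable f"
  shows "sq_integrable (\<lambda>t. c * f t)"
  using assms by (auto simp: sq_integrable_def norm_mult power_mult_distrib)

lemma sq_integrable_uminus:
  assumes "sq_integrable f"
  shows "sq_integrable (\<lambda>t. - f t)"
  using sq_integrable_mult[OF assms, of "-1"] by simp

lemma borel_measurable_cnj [measurable]:
  "f \<in> borel_measurable M \<Longrightarrow> (\<lambda>t. cnj (f t)) \<in> borel_measurable M"
  by (rule borel_measurable_continuous_on[where f = cnj]) (intro continuous_intros)

lemma sq_integrable_imp_integrable_mult_cnj:
  assumes "sq_integrable f" "sq_integrable g"
  shows "integrable lborel (\<lambda>t. f t * cnj (g t))"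
proof -
  have [measurable]: "f \<in> borel_measurable borel" "g \<in> borel_measurable borel"
    using assms by (auto simp: sq_integrable_def)
  have "integrable lborel (\<lambda>t. (cmod (f t))\<^sup>2 + (cmod (g t))\<^sup>2)"
    using assms by (auto simp: sq_integrable_def)
  then show ?thesis
  proof (rule Bochner_Integration.integrable_bound)
    have "cmod a * cmod b \<le> (cmod a)\<^sup>2 + (cmod b)\<^sup>2" for a b
    proof -
      have "2 * (cmod a * cmod b) \<le> (cmod a)\<^sup>2 + (cmod b)\<^sup>2"
        using sum_squares_bound[of "cmod a" "cmod b"] by (simp add: mult.assoc)
      moreover have "0 \<le> cmod a * cmod b" by simp
      ultimately show ?thesis by linarith
    qed
    then show "AE t in lborel. norm (f t * cnj (g t)) \<le> norm ((cmod (f t))\<^sup>2 + (cmod (g t))\<^sup>2)"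
      by (intro AE_I2) (simp add: norm_mult)
  qed measurable
qed

definition L2_rel :: "(real \<Rightarrow> complex) \<Rightarrow> (real \<Rightarrow> complex) \<Rightarrow> bool" where
  "L2_rel f g \<longleftrightarrow> sq_integrable f \<and> sq_integrable g \<and> (AE t in lborel. f t = g t)"

lemma L2_rel_I: "sq_integrable f \<Longrightarrow> f = g \<Longrightarrow> L2_rel f g"
  by (simp add: L2_rel_def)

lemma part_equivp_L2_rel: "part_equivp L2_rel"
proof (rule part_equivpI)
  show "\<exists>f. L2_rel f f" by (auto simp: L2_rel_def intro: sq_integrable_zero)
  show "symp L2_rel" by (auto simp: symp_def L2_rel_def)
  show "transp L2_rel" unfolding transp_def L2_rel_def by (auto elim: eventually_elim2)
qed

quotient_type L2 = "real \<Rightarrow> complex" / partial: L2_rel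
  by (rule part_equivp_L2_rel)

lift_definition scaleC_L2 :: "complex \<Rightarrow> L2 \<Rightarrow> L2" is "\<lambda>c f t. c * f t"
  by (auto simp: L2_rel_def intro: sq_integrable_mult)

lift_definition cinner_L2 :: "L2 \<Rightarrow> L2 \<Rightarrow> complex" is "\<lambda>f g. \<integral>t. f t * cnj (g t) \<partial>lborel"
  unfolding L2_rel_def sq_integrable_def
  by (rule integral_cong_AE)
    (auto elim: eventually_elim2 intro!: borel_measurable_times borel_measurable_cnj)

instantiation L2 :: real_inner
begin

lift_definition zero_L2 :: L2 is "\<lambda>_. 0"
  by (simp add: L2_rel_def sq_integrable_zero)

lift_definition plus_L2 :: "L2 \<Rightarrow> L2 \<Rightarrow> L2" is "\<lambda>f g t. f t + g t"
  by (auto simp: L2_rel_def intro: sq_integrable_add elim: eventually_elim2)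

lift_definition uminus_L2 :: "L2 \<Rightarrow> L2" is "\<lambda>f t. - f t"
  by (auto simp: L2_rel_def intro: sq_integrable_uminus)

definition "f - g = f + - g" for f g :: L2
definition "scaleR r f = scaleC_L2 (of_real r) f" for f :: L2
definition "inner f g = Re (cinner_L2 f g)" for f g :: L2
definition "norm f = sqrt (inner f f)" for f :: L2
definition "sgn f = scaleR (inverse (norm f)) f" for f :: L2
definition "dist f g = norm (f - g)" for f g :: L2
definition "uniformity = (INF e\<in>{0 <..}. principal {(f, g :: L2). dist f g < e})"
definition "open U = (\<forall>f\<in>U. eventually (\<lambda>(f', g). f' = f \<longrightarrow> g \<in> U) uniformity)" for U :: "L2 set"

instance
proof
  fix f g h :: L2 and a b r :: real and U :: "L2 set"
  show "f + g + h = f + (g + h)"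
    by transfer (auto intro!: L2_rel_I sq_integrable_add simp: L2_rel_def add.assoc)
  show "f + g = g + f"
    by transfer (auto intro!: L2_rel_I sq_integrable_add simp: L2_rel_def add.commute)
  show "0 + f = f"
    by transfer (auto intro!: L2_rel_I sq_integrable_add simp: L2_rel_def)
  show "- f + f = 0"
    by transfer (auto intro!: L2_rel_I sq_integrable_zero simp: L2_rel_def)
  show "f - g = f + - g" by (fact minus_L2_def)
  show "a *\<^sub>R (f + g) = a *\<^sub>R f + a *\<^sub>R g" unfolding scaleR_L2_def
    by transfer (auto intro!: L2_rel_I sq_integrable_add sq_integrable_mult
        simp: L2_rel_def distrib_left)
  show "(a + b) *\<^sub>R f = a *\<^sub>R f + b *\<^sub>R f" unfolding scaleR_L2_def
    by transfer (auto intro!: L2_rel_I sq_integrable_add sq_integrable_mult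
        simp: L2_rel_def distrib_right)
  show "a *\<^sub>R b *\<^sub>R f = (a * b) *\<^sub>R f" unfolding scaleR_L2_def
    by transfer (auto intro!: L2_rel_I sq_integrable_mult simp: L2_rel_def mult.assoc)
  show "1 *\<^sub>R f = f" unfolding scaleR_L2_def
    by transfer (auto intro!: L2_rel_I sq_integrable_mult simp: L2_rel_def)
  show "dist f g = norm (f - g)" by (fact dist_L2_def)
  show "sgn f = inverse (norm f) *\<^sub>R f" by (fact sgn_L2_def)
  show "uniformity = (INF e\<in>{0 <..}. principal {(f, g :: L2). dist f g < e})"
    by (fact uniformity_L2_def)
  show "open U = (\<forall>f\<in>U. eventually (\<lambda>(f', g). f' = f \<longrightarrow> g \<in> U) uniformity)"
    by (fact open_L2_def)
  show "norm f = sqrt (inner f f)" by (fact norm_L2_def)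
  have cnj: "cinner_L2 f g = cnj (cinner_L2 g f)"
    by transfer (simp add: mult.commute flip: Bochner_Integration.integral_cnj)
  show "inner f g = inner g f"
    unfolding inner_L2_def by (subst cnj) simp
  have "cinner_L2 (f + g) h = cinner_L2 f h + cinner_L2 g h"
    by transfer (auto simp: L2_rel_def distrib_right
        intro!: Bochner_Integration.integral_add sq_integrable_imp_integrable_mult_cnj)
  then show "inner (f + g) h = inner f h + inner g h"
    by (simp add: inner_L2_def)
  have "cinner_L2 (a *\<^sub>R f) g = of_real a * cinner_L2 f g"
    unfolding scaleR_L2_def by transfer (simp add: mult.assoc)
  then show "inner (a *\<^sub>R f) g = a * inner f g"
    by (simp add: inner_L2_def)
  have self: "inner f f = (\<integral>t. (cmod (F t))\<^sup>2 \<partial>lborel)"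
    if "f = abs_L2 F" "sq_integrable F" for f F
  proof -
    have "cinner_L2 f f = (\<integral>t. complex_of_real ((cmod (F t))\<^sup>2) \<partial>lborel)"
      unfolding that(1) using that(2)
      by (subst cinner_L2.abs_eq)
        (auto simp: L2_rel_def complex_norm_square simp del: of_real_power)
    then show ?thesis by (simp add: inner_L2_def del: of_real_power)
  qed
  have "\<exists>F. f = abs_L2 F \<and> sq_integrable F"
    by (induction f rule: L2.abs_induct) (auto simp: L2_rel_def)
  then obtain F where F: "f = abs_L2 F" "sq_integrable F" by blast
  show "0 \<le> inner f f" by (simp add: self[OF F])
  show "inner f f = 0 \<longleftrightarrow> f = 0"
  proof
    assume "inner f f = 0"
    then have "AE t in lborel. (cmod (F t))\<^sup>2 = 0"
      using F(2) unfolding self[OF F] sq_integrable_def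
      by (subst (asm) integral_nonneg_eq_0_iff_AE) auto
    then have "L2_rel F (\<lambda>_. 0)"
      using F(2) by (auto simp: L2_rel_def sq_integrable_zero)
    then show "f = 0"
      unfolding F(1) zero_L2_def by (rule Quotient_rel_abs[OF Quotient_L2])
  next
    assume "f = 0"
    then show "inner f f = 0"
      using self[of 0 "\<lambda>_. 0"] by (simp add: zero_L2_def sq_integrable_zero)
  qed
qed

end

global_interpretation L2: vector_space scaleC_L2
proof
  fix a b :: complex and f g :: L2
  show "scaleC_L2 a (f + g) = scaleC_L2 a f + scaleC_L2 a g"
    by transfer (auto intro!: L2_rel_I sq_integrable_add sq_integrable_mult
        simp: L2_rel_def distrib_left)
  show "scaleC_L2 (a + b) f = scaleC_L2 a f + scaleC_L2 b f"
    by transfer (auto intro!: L2_rel_I sq_integrable_add sq_integrable_mult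
        simp: L2_rel_def distrib_right)
  show "scaleC_L2 a (scaleC_L2 b f) = scaleC_L2 (a * b) f"
    by transfer (auto intro!: L2_rel_I sq_integrable_mult simp: L2_rel_def mult.assoc)
  show "scaleC_L2 1 f = f"
    by transfer (auto intro!: L2_rel_I sq_integrable_mult simp: L2_rel_def)
qed

text \<open>The complex dimension of a subspace; all infinite dimensions are identified.\<close>

definition edim_L2 :: "L2 set \<Rightarrow> enat" where
  "edim_L2 V = (if \<exists>B. finite B \<and> V \<subseteq> L2.span B then enat (L2.dim V) else \<infinity>)"

section \<open>Spectral measures\<close>

definition orth_projection :: "(L2 \<Rightarrow> L2) \<Rightarrow> bool" where
  "orth_projection P \<longleftrightarrow>
     Vector_Spaces.linear scaleC_L2 scaleC_L2 P \<and>
     (\<forall>f. P (P f) = P f) \<and>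
     (\<forall>f g. cinner_L2 (P f) g = cinner_L2 f (P g))"

text \<open>Countable additivity is meant in the strong operator topology, i.e. pointwise with
  respect to the norm. Only the values of \<open>E\<close> on Borel sets matter.\<close>

definition projection_valued_measure :: "(real set \<Rightarrow> L2 \<Rightarrow> L2) \<Rightarrow> bool" where
  "projection_valued_measure E \<longleftrightarrow>
     (\<forall>B \<in> sets borel. orth_projection (E B)) \<and>
     E UNIV = id \<and>
     (\<forall>B :: nat \<Rightarrow> real set. range B \<subseteq> sets borel \<longrightarrow> disjoint_family B \<longrightarrow>
        (\<forall>f. (\<lambda>n. E (B n) f) sums E (\<Union>n. B n) f))"

text \<open>The scalar measure \<open>B \<mapsto> \<langle>E(B)f, f\<rangle>\<close>; note that \<open>inner\<close> is the real part of \<open>cinner_L2\<close>.\<close>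

definition scalar_spectral_measure :: "(real set \<Rightarrow> L2 \<Rightarrow> L2) \<Rightarrow> L2 \<Rightarrow> real measure" where
  "scalar_spectral_measure E f = measure_of UNIV (sets borel) (\<lambda>B. ennreal (inner (E B f) f))"

text \<open>Unbounded operators are represented by their graphs.\<close>

definition linear_graph :: "(L2 \<times> L2) set \<Rightarrow> bool" where
  "linear_graph T \<longleftrightarrow>
     (0, 0) \<in> T \<and>
     (\<forall>(f, u) \<in> T. \<forall>(g, v) \<in> T. (f + g, u + v) \<in> T) \<and>
     (\<forall>c. \<forall>(f, u) \<in> T. (scaleC_L2 c f, scaleC_L2 c u) \<in> T)"

text \<open>\<open>E\<close> is the spectral measure of \<open>T\<close>, that is \<open>T = \<integral>\<lambda> dE(\<lambda>)\<close>: the domain consists of all \<open>f\<close>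
  with \<open>\<integral>\<lambda>\<^sup>2 d\<langle>E(\<lambda>)f, f\<rangle> < \<infinity>\<close>, and \<open>\<langle>Tf, f\<rangle> = \<integral>\<lambda> d\<langle>E(\<lambda>)f, f\<rangle>\<close> on it. As the space is complex
  and the domain is dense, polarization shows that these two conditions determine the linear
  operator \<open>T\<close> from \<open>E\<close>; in particular \<open>T\<close> is single-valued and self-adjoint.\<close>

definition is_spectral_measure_of :: "(real set \<Rightarrow> L2 \<Rightarrow> L2) \<Rightarrow> (L2 \<times> L2) set \<Rightarrow> bool" where
  "is_spectral_measure_of E T \<longleftrightarrow>
     projection_valued_measure E \<and>
     linear_graph T \<and>
     Domain T = {f. integrable (scalar_spectral_measure E f) (\<lambda>s. s\<^sup>2)} \<and>
     (\<forall>(f, u) \<in> T. cinner_L2 u f = complex_of_real (\<integral>s. s \<partial>scalar_spectral_measure E f))"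

text \<open>The number of negative squares of the self-adjoint operator with spectral measure \<open>E\<close>.\<close>

definition negative_squares :: "(real set \<Rightarrow> L2 \<Rightarrow> L2) \<Rightarrow> enat" where
  "negative_squares E = edim_L2 (range (E {..<0}))"

section \<open>Schroedinger operators with delta'-interactions\<close>

definition abs_continuous_on_interval :: "real \<Rightarrow> real \<Rightarrow> (real \<Rightarrow> complex) \<Rightarrow> bool" where
  "abs_continuous_on_interval a b f \<longleftrightarrow>
     (\<forall>\<epsilon>>0. \<exists>\<delta>>0. \<forall>(n :: nat) u v.
        (\<forall>i<n. a \<le> u i \<and> u i \<le> v i \<and> v i \<le> b) \<longrightarrow>
        disjoint_family_on (\<lambda>i. {u i<..<v i}) {..<n} \<longrightarrow>
        (\<Sum>i<n. v i - u i) < \<delta> \<longrightarrow>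
        (\<Sum>i<n. cmod (f (v i) - f (u i))) < \<epsilon>)"

definition AC_loc :: "real set \<Rightarrow> (real \<Rightarrow> complex) \<Rightarrow> bool" where
  "AC_loc S f \<longleftrightarrow> (\<forall>a b. {a..b} \<subseteq> S \<longrightarrow> abs_continuous_on_interval a b f)"

text \<open>\<open>f\<close> is in the Sobolev space \<open>W\<^sub>2\<^sup>2(\<real> \<setminus> X)\<close>, with derivatives \<open>f1 = f'\<close> and \<open>f2 = f''\<close>.
  Here \<open>f1\<close> is the locally absolutely continuous representative of \<open>f'\<close>, so \<open>f' = f1\<close> holds
  everywhere off \<open>X\<close>, whereas \<open>f''\<close> exists only almost everywhere.\<close>

definition W22 :: "real set \<Rightarrow> (real \<Rightarrow> complex) \<Rightarrow> (real \<Rightarrow> complex) \<Rightarrow> (real \<Rightarrow> complex) \<Rightarrow> bool" where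
  "W22 X f f1 f2 \<longleftrightarrow>
     sq_integrable f \<and> AC_loc (- X) f \<and> AC_loc (- X) f1 \<and> sq_integrable f2 \<and>
     (\<forall>t \<in> - X. (f has_vector_derivative f1 t) (at t)) \<and>
     (AE t in lborel. t \<in> - X \<longrightarrow> (f1 has_vector_derivative f2 t) (at t))"

text \<open>In the definition below, \<open>c = f'(x\<^sub>k+) = f'(x\<^sub>k-)\<close>, \<open>l = f(x\<^sub>k-)\<close> and \<open>r = f(x\<^sub>k+)\<close>; the limits
  exist for every function in \<open>W\<^sub>2\<^sup>2(\<real> \<setminus> X)\<close>.\<close>

definition delta'_operator :: "(int \<Rightarrow> real) \<Rightarrow> (int \<Rightarrow> real) \<Rightarrow> (L2 \<times> L2) set" where
  "delta'_operator x \<beta> =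
     {(abs_L2 f, abs_L2 (\<lambda>t. - f2 t)) | f f1 f2.
        W22 (range x) f f1 f2 \<and>
        (\<forall>k. \<exists>c l r.
           (f1 \<longlongrightarrow> c) (at_left (x k)) \<and> (f1 \<longlongrightarrow> c) (at_right (x k)) \<and>
           (f \<longlongrightarrow> l) (at_left (x k)) \<and> (f \<longlongrightarrow> r) (at_right (x k)) \<and>
           r - l = complex_of_real (\<beta> k) * c)}"

definition ecard :: "'a set \<Rightarrow> enat" where
  "ecard A = (if finite A then enat (card A) else \<infinity>)"

definition num_negative :: "(int \<Rightarrow> real) \<Rightarrow> enat" where
  "num_negative \<beta> = ecard {k. \<beta> k < 0}"

end

(* Integrating by parts on each gap, <L f, f> equals the integral of |f'|^2 plus the sum of
   beta_k |f'(x_k)|^2. If only finitely many beta_k are negative, then <L f, f> >= 0 as soon as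
   f'(x_k) = 0 for those k; but <L f, f> < 0 for nonzero f in the range of E[-n, 0), so the boundary
   values f'(x_k) embed this range into a space of dimension kappa(beta).
   Conversely, for beta_k < 0 choose f_k with a jump beta_k at x_k and continuous derivative phi_k such that
   phi_k(x_j) = delta_jk, the integral of phi_k is -beta_k (so f_k has compact support) and phi_k is small
   in L^2: a narrow peak at x_k plus a low wave spread over many gaps. The form is negative definite on
   the span of finitely many f_k, so E(-oo, 0) is injective there. *)
theory Submission
  imports Defs
begin

section \<open>Absolutely continuous functions\<close>

text \<open>For a general element of the domain neither f' in L^2 nor convergence of the sum of
  beta_k |f'(x_k)|^2 is established. The identity of the overview is therefore replaced by an
  inequality on compact intervals: |f'|^2 is dropped, and the boundary terms Re (f' cnj f) are made
  small only in the direction that matters, along suitable endpoints. Truncation to [-n, 0) is used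
  because a vector in the range of E(-oo, 0) need not lie in the domain. For the lower bound, <L
  f_k, f_l> is the integral of phi_k phi_l plus beta_k delta_kl. The condition phi_k(x_j) = delta_jk
  makes the jump part diagonal, so small L^2 norms turn the rest into a perturbation dominated by
  diag(beta). A prescribed integral and a small norm are compatible because the line is infinite:
  mass q carried by M disjoint equal bumps costs only a multiple of q^2 / M. The lower bound on the
  gaps leaves room for such bumps of one common shape.\<close>

lemma abs_continuousE:
  assumes "abs_continuous_on_interval a b F" and "0 < e"
  obtains \<delta> where "\<delta> > 0" and "\<forall>(n::nat) u v. (\<forall>i<n. a \<le> u i \<and> u i \<le> v i \<and> v i \<le> b) \<longrightarrow>
        disjoint_family_on (\<lambda>i. {u i<..<v i}) {..<n} \<longrightarrow> (\<Sum>i<n. v i - u i) < \<delta>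
        \<longrightarrow> (\<Sum>i<n. cmod (F (v i) - F (u i))) < e"
  using assms(1)[unfolded abs_continuous_on_interval_def, THEN spec, THEN mp, OF assms(2)]
  by (elim exE conjE)

text \<open>Off a null set \<open>N\<close> the usual Henstock argument applies. For tags in \<open>N\<close> the gauge is chosen inside an
  open set of small measure containing \<open>N\<close>, so that absolute continuity bounds their increments of \<open>F\<close>.\<close>
lemma ftc_abs_continuous:
  fixes F g :: "real \<Rightarrow> complex"
  assumes ab: "a \<le> b" and ac: "abs_continuous_on_interval a b F"
    and ae: "AE t in lborel. a < t \<longrightarrow> t < b \<longrightarrow> (F has_vector_derivative g t) (at t)"
  shows "(g has_integral F b - F a) {a..b}"
proof -
  obtain N0 where N0: "N0 \<in> null_sets lborel"
      "{t. \<not> (a < t \<longrightarrow> t < b \<longrightarrow> (F has_vector_derivative g t) (at t))} \<subseteq> N0"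
    using ae by (auto simp: eventually_ae_filter)
  \<comment> \<open>The derivative is assumed only inside the open interval, so the endpoints join
    the exceptional set.\<close>
  define N where "N = N0 \<union> {a, b}"
  have Nnull: "N \<in> null_sets lborel"
    using N0(1) unfolding N_def by (intro null_sets.Un) (auto intro!: finite_imp_null_set_lborel)
  then have Nleb: "N \<in> null_sets lebesgue" by (rule null_sets_completionI)
  have der: "(F has_vector_derivative g t) (at t)" if "t \<in> {a..b}" "t \<notin> N" for t
    using that N0(2) unfolding N_def by force
  \<comment> \<open>With value 0 on \<open>N\<close>, a tag in \<open>N\<close> contributes only its
    increment of \<open>F\<close> to the error.\<close>
  define g' where "g' t = (if t \<in> N then 0 else g t)" for t
  have "(g' has_integral F b - F a) {a..b}"
    unfolding has_integral_real
  proof (intro allI impI)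
    fix e :: real assume e: "e > 0"
    \<comment> \<open>The summand 1 keeps the denominator positive when a = b.\<close>
    define e1 where "e1 = e / (2 * (b - a + 1))"
    have e1: "e1 > 0" using e ab by (simp add: e1_def)
    have "e1 * (b - a) < e1 * (b - a + 1)" using e1 by simp
    also have "\<dots> = e / 2" using ab by (simp add: e1_def field_simps)
    finally have e1ab: "e1 * (b - a) < e / 2" .
    obtain \<delta> where \<delta>: "\<delta> > 0" and \<delta>2: "\<forall>(n::nat) u v. (\<forall>i<n. a \<le> u i \<and> u i \<le> v i \<and> v i \<le> b) \<longrightarrow>
        disjoint_family_on (\<lambda>i. {u i<..<v i}) {..<n} \<longrightarrow> (\<Sum>i<n. v i - u i) < \<delta>
        \<longrightarrow> (\<Sum>i<n. cmod (F (v i) - F (u i))) < e / 2"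
      by (rule abs_continuousE[OF ac half_gt_zero[OF e]])
    obtain T where T: "open T" "N \<subseteq> T" "emeasure lebesgue (T - N) < ennreal \<delta>"
      using sets_lebesgue_outer_open[of N \<delta>] Nleb \<delta> by blast
    have "emeasure lborel T \<le> emeasure lborel (N \<union> (T - N))"
      using T Nnull by (intro emeasure_mono) auto
    also have "\<dots> \<le> emeasure lborel N + emeasure lborel (T - N)"
      using T Nnull by (intro emeasure_subadditive) auto
    also have "\<dots> = emeasure lebesgue (T - N)"
    proof -
      have "T - N \<in> sets lborel" using T(1) null_setsD2[OF Nnull] by auto
      then show ?thesis using null_setsD1[OF Nnull] by simp
    qed
    finally have Tm: "emeasure lborel T < ennreal \<delta>" using T(3) by simp
    have "\<exists>d>0. (t \<in> N \<longrightarrow> ball t d \<subseteq> T) \<and> (t \<in> {a..b} - N \<longrightarrow>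
       (\<forall>y. norm (y - t) < d \<longrightarrow> norm (F y - F t - (y - t) *\<^sub>R g t) \<le> e1 * norm (y - t)))" for t
    proof (cases "t \<in> N")
      case True
      then show ?thesis using T open_contains_ball by (metis DiffD2 subsetD)
    next
      case nN: False
      show ?thesis
      proof (cases "t \<in> {a..b}")
        case True
        have "\<exists>d>0. \<forall>y. norm (y - t) < d \<longrightarrow> norm (F y - F t - (y - t) *\<^sub>R g t) \<le> e1 * norm (y - t)"
          using der[OF True nN, unfolded has_vector_derivative_def has_derivative_at_alt] e1 by blast
        then show ?thesis using nN by blast
      next
        case False
        then show ?thesis using nN by (intro exI[of _ 1]) auto
      qed
    qed
    then obtain d where dd: "\<forall>t. d t > 0 \<and> (t \<in> N \<longrightarrow> ball t (d t) \<subseteq> T) \<and> (t \<in> {a..b} - N \<longrightarrow>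
       (\<forall>y. norm (y - t) < d t \<longrightarrow> norm (F y - F t - (y - t) *\<^sub>R g t) \<le> e1 * norm (y - t)))"
      using choice[of "\<lambda>t d. d > 0 \<and> (t \<in> N \<longrightarrow> ball t d \<subseteq> T) \<and> (t \<in> {a..b} - N \<longrightarrow>
       (\<forall>y. norm (y - t) < d \<longrightarrow> norm (F y - F t - (y - t) *\<^sub>R g t) \<le> e1 * norm (y - t)))"] by blast
    have d: "d t > 0" "t \<in> N \<Longrightarrow> ball t (d t) \<subseteq> T"
       "t \<in> {a..b} - N \<Longrightarrow> norm (y - t) < d t \<Longrightarrow>
          norm (F y - F t - (y - t) *\<^sub>R g t) \<le> e1 * norm (y - t)" for t y
      using dd by blast+
    show "\<exists>\<gamma>. gauge \<gamma> \<and> (\<forall>D. D tagged_division_of {a..b} \<and> \<gamma> fine D \<longrightarrow>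
         norm ((\<Sum>(x, k)\<in>D. measure lborel k *\<^sub>R g' x) - (F b - F a)) < e)"
    proof (rule exI[of _ "\<lambda>t. ball t (d t)"], intro conjI allI impI)
      show "gauge (\<lambda>t. ball t (d t))" using d(1) gauge_ball_dependent by blast
    next
      fix p assume "p tagged_division_of {a..b} \<and> (\<lambda>t. ball t (d t)) fine p"
      then have ptag: "p tagged_division_of {a..b}" and fine: "(\<lambda>t. ball t (d t)) fine p" by auto
      note pD = tagged_division_ofD[OF ptag]
      have fin: "finite p" by (rule pD(1))
      have K: "x \<in> K \<and> a \<le> Inf K \<and> Inf K \<le> x \<and> x \<le> Sup K \<and> Sup K \<le> b
          \<and> K = {Inf K..Sup K} \<and> measure lborel K = Sup K - Inf K \<and> K \<subseteq> ball x (d x)" if xK: "(x, K) \<in> p" for x K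
      proof -
        obtain u v where uv: "K = {u..v}" using pD(4)[OF xK] by auto
        have "x \<in> K" "K \<subseteq> {a..b}" using pD(2,3) xK by auto
        moreover have "K \<subseteq> ball x (d x)" using fineD[OF fine xK] .
        ultimately show ?thesis unfolding uv by auto
      qed
      have sums: "b - a = (\<Sum>(x,K)\<in>p. Sup K - Inf K)" "F b - F a = (\<Sum>(x,K)\<in>p. F (Sup K) - F (Inf K))"
        using additive_tagged_division_1[OF ab, of p "\<lambda>x. x"] additive_tagged_division_1[OF ab, of p F] ptag by auto
      define pN where "pN = {(x,K) \<in> p. x \<in> N}"
      define pG where "pG = {(x,K) \<in> p. x \<notin> N}"
      have pp: "p = pN \<union> pG" "pN \<inter> pG = {}" and finN: "finite pN" "finite pG"
        using fin unfolding pN_def pG_def by (auto intro: finite_subset[OF _ fin])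
      have "(\<Sum>(x, k)\<in>p. measure lborel k *\<^sub>R g' x) - (F b - F a)
          = (\<Sum>(x, K)\<in>p. measure lborel K *\<^sub>R g' x - (F (Sup K) - F (Inf K)))"
        unfolding sums(2) by (simp add: sum_subtractf case_prod_beta)
      also have "\<dots> = (\<Sum>(x, K)\<in>pN. measure lborel K *\<^sub>R g' x - (F (Sup K) - F (Inf K)))
           + (\<Sum>(x, K)\<in>pG. measure lborel K *\<^sub>R g' x - (F (Sup K) - F (Inf K)))"
        by (subst pp(1), rule sum.union_disjoint[OF finN pp(2)])
      finally have split: "norm ((\<Sum>(x, k)\<in>p. measure lborel k *\<^sub>R g' x) - (F b - F a)) \<le>
          norm (\<Sum>(x, K)\<in>pN. measure lborel K *\<^sub>R g' x - (F (Sup K) - F (Inf K)))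
           + norm (\<Sum>(x, K)\<in>pG. measure lborel K *\<^sub>R g' x - (F (Sup K) - F (Inf K)))"
        by (simp add: norm_triangle_ineq)
      have "norm (\<Sum>(x, K)\<in>pG. measure lborel K *\<^sub>R g' x - (F (Sup K) - F (Inf K))) \<le> (\<Sum>(x,K)\<in>pG. e1 * (Sup K - Inf K))"
      proof (rule sum_norm_le, safe)
        fix x K assume xK: "(x, K) \<in> pG"
        then have xp: "(x, K) \<in> p" and xN: "x \<notin> N" by (auto simp: pG_def)
        note k = K[OF xp]
        have "Inf K \<in> K" "Sup K \<in> K" using k by (metis atLeastAtMost_iff order.refl order.trans)+
        then have inb: "norm (Inf K - x) < d x" "norm (Sup K - x) < d x" using k by (auto simp: dist_norm norm_minus_commute)
        have xab: "x \<in> {a..b} - N" using k xN by auto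
        \<comment> \<open>Straddling: both ends are compared with the tag. As the tag lies between
          them, the two error bounds add up to \<open>e1\<close> times the length of
          \<open>K\<close>.\<close>
        let ?A = "F (Sup K) - F x - (Sup K - x) *\<^sub>R g x" let ?B = "F (Inf K) - F x - (Inf K - x) *\<^sub>R g x"
        have "measure lborel K *\<^sub>R g' x - (F (Sup K) - F (Inf K)) = ?B - ?A"
        proof -
          have "measure lborel K *\<^sub>R g' x = (Sup K - Inf K) *\<^sub>R g x" using k xN by (simp add: g'_def)
          then show ?thesis by (simp add: algebra_simps)
        qed
        then have "norm (measure lborel K *\<^sub>R g' x - (F (Sup K) - F (Inf K))) \<le> norm ?B + norm ?A"
          by (simp only: norm_triangle_ineq4)
        also have "\<dots> \<le> e1 * norm (Inf K - x) + e1 * norm (Sup K - x)"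
          using d(3)[OF xab inb(1)] d(3)[OF xab inb(2)] by (rule add_mono)
        also have "\<dots> = e1 * (Sup K - Inf K)" using k by (simp add: algebra_simps)
        finally show "norm (measure lborel K *\<^sub>R g' x - (F (Sup K) - F (Inf K))) \<le> e1 * (Sup K - Inf K)" .
      qed
      also have "\<dots> \<le> (\<Sum>(x,K)\<in>p. e1 * (Sup K - Inf K))"
      proof (rule sum_mono2[OF fin])
        fix z assume "z \<in> p - pG"
        then obtain x K where z: "z = (x, K)" "(x, K) \<in> p" by (cases z) auto
        then have "Inf K \<le> Sup K" using K[OF z(2)] by linarith
        then show "0 \<le> (case z of (x, K) \<Rightarrow> e1 * (Sup K - Inf K))" using e1 z by simp
      qed (use pp in auto)
      also have "\<dots> = e1 * (b - a)" unfolding sums(1) by (simp add: sum_distrib_left case_prod_beta)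
      finally have G: "norm (\<Sum>(x, K)\<in>pG. measure lborel K *\<^sub>R g' x - (F (Sup K) - F (Inf K))) < e / 2" using e1ab by simp
      \<comment> \<open>Absolute continuity is stated for families indexed by an initial segment of
        the naturals, so the intervals with tag in \<open>N\<close> are enumerated.\<close>
      obtain h where h: "bij_betw h {..<card pN} pN"
        using ex_bij_betw_nat_finite[OF finN(1)] by (auto simp: lessThan_atLeast0)
      define n where "n = card pN"
      define u where "u i = Inf (snd (h i))" for i
      define v where "v i = Sup (snd (h i))" for i
      have hi: "h i \<in> pN" if "i < n" for i using h that unfolding n_def bij_betw_def by auto
      have uv: "h i = (fst (h i), {u i..v i}) \<and> (fst (h i), {u i..v i}) \<in> p \<and> fst (h i) \<in> N \<and> a \<le> u i \<and> u i \<le> v i \<and> v i \<le> b" if "i < n" for i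
      proof -
        obtain x K where hk: "h i = (x, K)" by fastforce
        with hi[OF that] have "(x, K) \<in> p" "x \<in> N" by (auto simp: pN_def)
        with K[of x K] hk show ?thesis by (auto simp: u_def v_def)
      qed
      have uvle: "u i \<le> v i" if "i < n" for i using uv[OF that] by blast
      have disj: "disjoint_family_on (\<lambda>i. {u i<..<v i}) {..<n}"
        unfolding disjoint_family_on_def
      proof (intro ballI impI)
        fix i j assume ij: "i \<in> {..<n}" "j \<in> {..<n}" "i \<noteq> j"
        then have "h i \<noteq> h j" using h unfolding n_def bij_betw_def inj_on_def by auto
        then have ne: "(fst (h i), {u i..v i}) \<noteq> (fst (h j), {u j..v j})" using uv ij by (metis lessThan_iff)
        have "interior {u i..v i} \<inter> interior {u j..v j} = {}"
          using ij uv by (intro pD(5)[OF _ _ ne]) blast+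
        then show "{u i<..<v i} \<inter> {u j<..<v j} = {}" by simp
      qed
      have "ennreal (\<Sum>i<n. v i - u i) = (\<Sum>i<n. emeasure lborel {u i<..<v i})"
        using uvle by (subst sum_ennreal[symmetric]) (auto intro!: sum.cong)
      also have "\<dots> = emeasure lborel (\<Union>i<n. {u i<..<v i})"
        using disj by (intro sum_emeasure) auto
      also have "\<dots> \<le> emeasure lborel T"
      proof (intro emeasure_mono UN_least)
        fix i assume "i \<in> {..<n}"
        then have i: "(fst (h i), {u i..v i}) \<in> p" "fst (h i) \<in> N" using uv by blast+
        from K[OF i(1)] d(2)[OF i(2)] show "{u i<..<v i} \<subseteq> T" by (meson dual_order.trans greaterThanLessThan_subseteq_atLeastAtMost_iff order.refl)
      qed (use T in auto)
      finally have "ennreal (\<Sum>i<n. v i - u i) < ennreal \<delta>" using Tm by simp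
      then have "(\<Sum>i<n. v i - u i) < \<delta>" by (meson ennreal_leI not_less)
      with \<delta>2 disj uv have AC: "(\<Sum>i<n. cmod (F (v i) - F (u i))) < e / 2" by blast
      have "norm (\<Sum>(x, K)\<in>pN. measure lborel K *\<^sub>R g' x - (F (Sup K) - F (Inf K))) \<le> (\<Sum>(x,K)\<in>pN. cmod (F (Sup K) - F (Inf K)))"
        by (rule sum_norm_le) (auto simp: pN_def g'_def norm_minus_commute)
      also have "\<dots> = (\<Sum>i<n. cmod (F (v i) - F (u i)))"
        unfolding n_def u_def v_def by (subst sum.reindex_bij_betw[OF h, symmetric]) (simp add: case_prod_beta)
      finally show "norm ((\<Sum>(x, k)\<in>p. measure lborel k *\<^sub>R g' x) - (F b - F a)) < e"
        using split G AC by linarith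
    qed
  qed
  then show ?thesis
    by (rule has_integral_spike[of N, rotated 2]) (use Nleb in \<open>auto simp: negligible_iff_null_sets g'_def\<close>)
qed

lemma abs_continuous_imp_continuous_on:
  assumes "abs_continuous_on_interval a b F"
  shows "continuous_on {a..b} F"
  unfolding continuous_on_iff
proof (intro ballI allI impI)
  fix s e :: real assume s: "s \<in> {a..b}" and e: "0 < e"
  obtain \<delta> where \<delta>: "\<delta> > 0" and \<delta>2: "\<forall>(n::nat) u v. (\<forall>i<n. a \<le> u i \<and> u i \<le> v i \<and> v i \<le> b) \<longrightarrow>
        disjoint_family_on (\<lambda>i. {u i<..<v i}) {..<n} \<longrightarrow> (\<Sum>i<n. v i - u i) < \<delta>
        \<longrightarrow> (\<Sum>i<n. cmod (F (v i) - F (u i))) < e"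
    by (rule abs_continuousE[OF assms e])
  have "dist (F t) (F s) < e" if t: "t \<in> {a..b}" "dist t s < \<delta>" for t
  proof -
    have "(\<Sum>i<Suc 0. cmod (F (max s t) - F (min s t))) < e"
      using s t \<delta>2[rule_format, of "Suc 0" "\<lambda>_. min s t" "\<lambda>_. max s t"]
      by (auto simp: disjoint_family_on_def dist_real_def)
    then show ?thesis by (auto simp: max_def min_def dist_norm norm_minus_commute split: if_splits)
  qed
  then show "\<exists>d>0. \<forall>t\<in>{a..b}. dist t s < d \<longrightarrow> dist (F t) (F s) < e" using \<delta> by blast
qed

text \<open>A common criterion from which products and linear combinations both follow.\<close>

lemma abs_continuous_dominated:
  assumes F: "abs_continuous_on_interval a b F" and G: "abs_continuous_on_interval a b G" and M: "0 < M"
    and le: "\<And>u v. u \<in> {a..b} \<Longrightarrow> v \<in> {a..b} \<Longrightarrow>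
      cmod (H v - H u) \<le> M * cmod (F v - F u) + M * cmod (G v - G u)"
  shows "abs_continuous_on_interval a b H"
  unfolding abs_continuous_on_interval_def
proof (intro allI impI)
  fix e :: real assume "e > 0"
  then have e: "0 < e / (2 * M)" using M by simp
  obtain d1 where d1: "d1 > 0" and AF: "\<forall>(n::nat) u v. (\<forall>i<n. a \<le> u i \<and> u i \<le> v i \<and> v i \<le> b) \<longrightarrow>
      disjoint_family_on (\<lambda>i. {u i<..<v i}) {..<n} \<longrightarrow> (\<Sum>i<n. v i - u i) < d1
      \<longrightarrow> (\<Sum>i<n. cmod (F (v i) - F (u i))) < e / (2 * M)"
    by (rule abs_continuousE[OF F e])
  obtain d2 where d2: "d2 > 0" and AG: "\<forall>(n::nat) u v. (\<forall>i<n. a \<le> u i \<and> u i \<le> v i \<and> v i \<le> b) \<longrightarrow>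
      disjoint_family_on (\<lambda>i. {u i<..<v i}) {..<n} \<longrightarrow> (\<Sum>i<n. v i - u i) < d2
      \<longrightarrow> (\<Sum>i<n. cmod (G (v i) - G (u i))) < e / (2 * M)"
    by (rule abs_continuousE[OF G e])
  show "\<exists>\<delta>>0. \<forall>(n::nat) u v. (\<forall>i<n. a \<le> u i \<and> u i \<le> v i \<and> v i \<le> b) \<longrightarrow>
      disjoint_family_on (\<lambda>i. {u i<..<v i}) {..<n} \<longrightarrow> (\<Sum>i<n. v i - u i) < \<delta> \<longrightarrow>
      (\<Sum>i<n. cmod (H (v i) - H (u i))) < e"
  proof (rule exI[of _ "min d1 d2"], intro conjI allI impI)
    show "0 < min d1 d2" using d1 d2 by simp
    fix n :: nat and u v :: "nat \<Rightarrow> real"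
    assume uv: "\<forall>i<n. a \<le> u i \<and> u i \<le> v i \<and> v i \<le> b" and dis: "disjoint_family_on (\<lambda>i. {u i<..<v i}) {..<n}"
      and sm: "(\<Sum>i<n. v i - u i) < min d1 d2"
    have sF: "(\<Sum>i<n. cmod (F (v i) - F (u i))) < e / (2 * M)"
      using AF[THEN spec, THEN spec, THEN spec, of n u v] uv dis sm by simp
    have sG: "(\<Sum>i<n. cmod (G (v i) - G (u i))) < e / (2 * M)"
      using AG[THEN spec, THEN spec, THEN spec, of n u v] uv dis sm by simp
    have "(\<Sum>i<n. cmod (H (v i) - H (u i)))
       \<le> (\<Sum>i<n. M * cmod (F (v i) - F (u i)) + M * cmod (G (v i) - G (u i)))"
    proof (rule sum_mono)
      fix i assume "i \<in> {..<n}"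
      then have "u i \<in> {a..b}" "v i \<in> {a..b}" using uv by force+
      then show "cmod (H (v i) - H (u i)) \<le> M * cmod (F (v i) - F (u i)) + M * cmod (G (v i) - G (u i))"
        by (rule le)
    qed
    also have "\<dots> = M * (\<Sum>i<n. cmod (F (v i) - F (u i))) + M * (\<Sum>i<n. cmod (G (v i) - G (u i)))"
      by (simp add: sum.distrib sum_distrib_left)
    also have "\<dots> < M * (e / (2 * M)) + M * (e / (2 * M))"
      using sF sG M by (intro add_strict_mono mult_strict_left_mono) auto
    also have "\<dots> = e" using M by (simp add: field_simps)
    finally show "(\<Sum>i<n. cmod (H (v i) - H (u i))) < e" .
  qed
qed

lemma abs_continuous_mult_cnj:
  assumes F: "abs_continuous_on_interval a b F" and G: "abs_continuous_on_interval a b G"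
  shows "abs_continuous_on_interval a b (\<lambda>t. F t * cnj (G t))"
proof -
  have "bounded (F ` {a..b})" "bounded (G ` {a..b})"
    using F G by (auto intro!: compact_imp_bounded compact_continuous_image abs_continuous_imp_continuous_on)
  then obtain B C where BC: "\<And>t. t \<in> {a..b} \<Longrightarrow> cmod (F t) \<le> B" "\<And>t. t \<in> {a..b} \<Longrightarrow> cmod (G t) \<le> C"
    unfolding bounded_iff by (metis imageI)
  define M where "M = max 1 (max B C)"
  have M: "M > 0" "\<And>t. t \<in> {a..b} \<Longrightarrow> cmod (F t) \<le> M" "\<And>t. t \<in> {a..b} \<Longrightarrow> cmod (G t) \<le> M"
    using BC by (force simp: M_def)+
  show ?thesis
  proof (rule abs_continuous_dominated[OF F G M(1)])
    fix u v assume uv: "u \<in> {a..b}" "v \<in> {a..b}"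
    have "F v * cnj (G v) - F u * cnj (G u) = (F v - F u) * cnj (G v) + F u * cnj (G v - G u)"
      by (simp add: algebra_simps)
    then have "cmod (F v * cnj (G v) - F u * cnj (G u))
      \<le> cmod (F v - F u) * cmod (G v) + cmod (F u) * cmod (G v - G u)"
      using norm_triangle_ineq[of "(F v - F u) * cnj (G v)" "F u * cnj (G v - G u)"]
      by (simp only: norm_mult complex_mod_cnj)
    also have "\<dots> \<le> cmod (F v - F u) * M + M * cmod (G v - G u)"
      using M(1) M(2)[OF uv(1)] M(3)[OF uv(2)] by (intro add_mono mult_mono) auto
    finally show "cmod (F v * cnj (G v) - F u * cnj (G u)) \<le> M * cmod (F v - F u) + M * cmod (G v - G u)"
      by (simp add: mult.commute)
  qed
qed

lemma abs_continuous_lincomb: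
  assumes F: "abs_continuous_on_interval a b F" and G: "abs_continuous_on_interval a b G"
  shows "abs_continuous_on_interval a b (\<lambda>t. F t + s * G t)"
proof (rule abs_continuous_dominated[OF F G, of "1 + cmod s"])
  show "0 < 1 + cmod s" by (simp add: add_pos_nonneg)
  fix u v
  have "F v + s * G v - (F u + s * G u) = (F v - F u) + s * (G v - G u)"
    by (simp add: algebra_simps)
  then have "cmod (F v + s * G v - (F u + s * G u)) \<le> 1 * cmod (F v - F u) + cmod s * cmod (G v - G u)"
    using norm_triangle_ineq[of "F v - F u" "s * (G v - G u)"] by (simp only: norm_mult mult_1_left)
  also have "\<dots> \<le> (1 + cmod s) * cmod (F v - F u) + (1 + cmod s) * cmod (G v - G u)"
    by (intro add_mono mult_right_mono) auto
  finally show "cmod (F v + s * G v - (F u + s * G u))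
    \<le> (1 + cmod s) * cmod (F v - F u) + (1 + cmod s) * cmod (G v - G u)" .
qed

lemma abs_continuous_C1:
  assumes der: "\<And>t. t \<in> {a..b} \<Longrightarrow> (f has_vector_derivative f' t) (at t)" and cont: "continuous_on {a..b} f'"
  shows "abs_continuous_on_interval a b f"
proof -
  have "bounded (f' ` {a..b})" by (intro compact_imp_bounded compact_continuous_image cont) auto
  then obtain M where M: "0 < M" "\<And>t. t \<in> {a..b} \<Longrightarrow> cmod (f' t) \<le> M"
    by (auto simp: bounded_pos)
  have lip: "cmod (f v - f u) \<le> M * (v - u)" if "a \<le> u" "u \<le> v" "v \<le> b" for u v
  proof -
    have "norm (f v - f u) \<le> M * norm (v - u)"
    proof (rule differentiable_bound[of "{a..b}" f "\<lambda>t h. h *\<^sub>R f' t"])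
      fix t assume t: "t \<in> {a..b}"
      show "(f has_derivative (\<lambda>h. h *\<^sub>R f' t)) (at t within {a..b})"
        using der[OF t] unfolding has_vector_derivative_def by (rule has_derivative_at_withinI)
      show "onorm (\<lambda>h. h *\<^sub>R f' t) \<le> M"
        using M t by (intro onorm_bound) (auto simp: mult.commute[of M] intro!: mult_left_mono)
    qed (use that in auto)
    then show ?thesis using that by simp
  qed
  show ?thesis
    unfolding abs_continuous_on_interval_def
  proof (intro allI impI)
    fix e :: real assume e: "0 < e"
    show "\<exists>\<delta>>0. \<forall>(n::nat) u v. (\<forall>i<n. a \<le> u i \<and> u i \<le> v i \<and> v i \<le> b) \<longrightarrow>
      disjoint_family_on (\<lambda>i. {u i<..<v i}) {..<n} \<longrightarrow> (\<Sum>i<n. v i - u i) < \<delta> \<longrightarrow>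
      (\<Sum>i<n. cmod (f (v i) - f (u i))) < e"
    proof (rule exI[of _ "e / M"], intro conjI allI impI)
      show "0 < e / M" using e M by simp
      fix n :: nat and u v :: "nat \<Rightarrow> real"
      assume uv: "\<forall>i<n. a \<le> u i \<and> u i \<le> v i \<and> v i \<le> b" and sm: "(\<Sum>i<n. v i - u i) < e / M"
      have "(\<Sum>i<n. cmod (f (v i) - f (u i))) \<le> (\<Sum>i<n. M * (v i - u i))"
        using uv lip by (intro sum_mono) auto
      also have "\<dots> = M * (\<Sum>i<n. v i - u i)" by (simp add: sum_distrib_left)
      also have "\<dots> < M * (e / M)" using sm M by (intro mult_strict_left_mono) auto
      finally show "(\<Sum>i<n. cmod (f (v i) - f (u i))) < e" using M by simp
    qed
  qed
qed

text \<open>The product \<open>f1 * cnj f\<close> is differentiable only almost everywhere, because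
  \<open>f1\<close> is; this is what the fundamental theorem for absolutely continuous functions is
  for.\<close>

lemma W22_integration_by_parts:
  assumes W: "W22 X f f1 f2" and ab: "a \<le> b" "{a..b} \<subseteq> - X"
  shows "((\<lambda>t. f2 t * cnj (f t) + f1 t * cnj (f1 t)) has_integral
            f1 b * cnj (f b) - f1 a * cnj (f a)) {a..b}"
proof (rule ftc_abs_continuous[OF ab(1), where F = "\<lambda>t. f1 t * cnj (f t)"])
  show "abs_continuous_on_interval a b (\<lambda>t. f1 t * cnj (f t))"
    using W ab by (intro abs_continuous_mult_cnj) (auto simp: W22_def AC_loc_def)
  have "AE t in lborel. t \<in> - X \<longrightarrow> (f1 has_vector_derivative f2 t) (at t)"
    using W by (simp add: W22_def)
  then show "AE t in lborel. a < t \<longrightarrow> t < b \<longrightarrow>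
     ((\<lambda>t. f1 t * cnj (f t)) has_vector_derivative f2 t * cnj (f t) + f1 t * cnj (f1 t)) (at t)"
  proof eventually_elim
    case (elim t)
    show ?case
    proof (intro impI)
      assume "a < t" "t < b"
      then have "t \<in> {a..b}" by simp
      then have t: "t \<in> - X" using ab(2) by blast
      then have "(f has_vector_derivative f1 t) (at t)" using W by (simp add: W22_def)
      from has_vector_derivative_mult[OF elim[rule_format, OF t] has_vector_derivative_cnj[OF this]]
      show "((\<lambda>t. f1 t * cnj (f t)) has_vector_derivative f2 t * cnj (f t) + f1 t * cnj (f1 t)) (at t)"
        by (simp add: add.commute)
    qed
  qed
qed

section \<open>Nonnegativity of the form\<close>

text \<open>If \<open>u\<close> were at least \<delta> on a whole window of length \<open>w\<close>,
  that window alone would contribute \<delta> w, more than the integral of \<open>u\<close> beyond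
  \<open>M\<close>.\<close>

lemma tail_small_at_top:
  fixes u :: "real \<Rightarrow> real"
  assumes u: "integrable lborel u" "\<And>t. 0 \<le> u t" and w: "0 < w" and d: "0 < \<delta>"
  obtains M where "\<And>s. M \<le> s \<Longrightarrow> \<exists>q\<in>{s<..<s + w}. u q < \<delta>"
proof -
  have "((\<lambda>y. \<integral>t. indicator {..y} t *\<^sub>R u t \<partial>lborel) \<longlongrightarrow> integral\<^sup>L lborel u) at_top"
    by (rule tendsto_integral_at_top[OF _ u(1)]) simp
  then have "\<forall>\<^sub>F y in at_top. integral\<^sup>L lborel u - \<delta> * w < (\<integral>t. indicator {..y} t *\<^sub>R u t \<partial>lborel)"
    by (rule order_tendstoD) (use w d in simp)
  then obtain M where M: "\<And>y. M \<le> y \<Longrightarrow> integral\<^sup>L lborel u - \<delta> * w < (\<integral>t. indicator {..y} t *\<^sub>R u t \<partial>lborel)"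
    by (auto simp: eventually_at_top_linorder)
  have "\<exists>q\<in>{s<..<s + w}. u q < \<delta>" if s: "M \<le> s" for s
  proof (rule ccontr)
    assume "\<not> ?thesis"
    then have ge: "\<delta> \<le> u q" if "s < q" "q < s + w" for q using that by force
    have i1: "integrable lborel (\<lambda>t. indicator {..s} t *\<^sub>R u t)"
      using u by (intro integrable_mult_indicator) auto
    have i2: "integrable lborel (\<lambda>t. indicator {s<..<s + w} t *\<^sub>R \<delta>)"
      by (intro integrable_scaleR_left integrable_real_indicator) (auto simp: w less_imp_le)
    have "(\<integral>t. indicator {..s} t *\<^sub>R u t \<partial>lborel) + (\<integral>t. indicator {s<..<s + w} t *\<^sub>R \<delta> \<partial>lborel)
       = (\<integral>t. indicator {..s} t *\<^sub>R u t + indicator {s<..<s + w} t *\<^sub>R \<delta> \<partial>lborel)"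
      using i1 i2 by (rule Bochner_Integration.integral_add[symmetric])
    also have "\<dots> \<le> integral\<^sup>L lborel u"
      using i1 i2 u ge by (intro integral_mono) (auto simp: indicator_def intro: less_imp_le)
    finally have "(\<integral>t. indicator {..s} t *\<^sub>R u t \<partial>lborel) + w * \<delta> \<le> integral\<^sup>L lborel u"
      using w by simp
    then show False using M[OF s] by (simp add: mult.commute)
  qed
  then show ?thesis using that by blast
qed

lemma tail_small_at_bot:
  fixes u :: "real \<Rightarrow> real"
  assumes u: "integrable lborel u" "\<And>t. 0 \<le> u t" and w: "0 < w" and d: "0 < \<delta>"
  obtains M where "\<And>s. s \<le> M \<Longrightarrow> \<exists>q\<in>{s<..<s + w}. u q < \<delta>"
proof -
  have "integrable lborel (\<lambda>t. u (- t))" using lborel_integrable_real_affine[OF u(1), of "-1" 0] by simp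
  then obtain M where M: "\<And>s. M \<le> s \<Longrightarrow> \<exists>q\<in>{s<..<s + w}. u (- q) < \<delta>"
    using tail_small_at_top[of "\<lambda>t. u (- t)" w \<delta>] u w d by auto
  \<comment> \<open>Reflection carries the window (s, s + w) to (-s - w, -s), whose left end must be
    at least \<open>M\<close>.\<close>
  have "\<exists>q\<in>{s<..<s + w}. u q < \<delta>" if s: "s \<le> - M - w" for s
  proof -
    obtain q where "q \<in> {- s - w<..<- s - w + w}" "u (- q) < \<delta>" using M[of "- s - w"] s by fastforce
    then show ?thesis by (intro bexI[of _ "- q"]) auto
  qed
  then show ?thesis using that by blast
qed

text \<open>\<open>d\<close> is a common lower bound of the gaps. It makes the points escape to both
  infinities and lets windows and bumps of width \<open>d\<close> fit into every gap.\<close>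

locale point_sequence =
  fixes x :: "int \<Rightarrow> real" and d :: real
  assumes mono: "strict_mono x" and d: "0 < d" and gap: "\<And>k. d \<le> x (k + 1) - x k"
begin

lemma in_gap: "x k < t \<Longrightarrow> t < x (k + 1) \<Longrightarrow> t \<notin> range x"
proof
  assume t: "x k < t" "t < x (k + 1)" "t \<in> range x"
  then obtain m where "t = x m" by blast
  with t have "k < m" "m < k + 1" using mono by (auto simp: strict_mono_less)
  then show False by simp
qed

lemma ge_linear: "0 \<le> k \<Longrightarrow> x 0 + d * of_int k \<le> x k"
proof (induction k rule: int_ge_induct)
  case (step i) then show ?case using gap[of i] by (simp add: algebra_simps)
qed simp

lemma le_linear: "k \<le> 0 \<Longrightarrow> x k \<le> x 0 + d * of_int k"
proof (induction k rule: int_le_induct)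
  case (step i) then show ?case using gap[of "i - 1"] by (simp add: algebra_simps)
qed simp

lemma unbounded_above: "\<exists>k\<ge>0. M \<le> x k"
proof -
  obtain n where "(M - x 0) / d < real n" using reals_Archimedean2 by blast
  then have "M - x 0 < d * real n" using d by (simp add: field_simps)
  then show ?thesis using ge_linear[of "int n"] by (intro exI[of _ "int n"]) auto
qed

lemma unbounded_below: "\<exists>k\<le>0. x k \<le> M"
proof -
  obtain n where "(x 0 - M) / d < real n" using reals_Archimedean2 by blast
  then have "x 0 - M < d * real n" using d by (simp add: field_simps)
  then show ?thesis using le_linear[of "- int n"] by (intro exI[of _ "- int n"]) auto
qed

end


text \<open>A representative of a domain element with its boundary values named; \<open>sgn\<close>
  expresses that f' vanishes at the points of negative strength. Below, \<open>g\<close> is the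
  boundary term of the integration by parts, and the integral of \<open>h\<close> is minus the real
  part of the form, so the goal is that it is at most 0.\<close>

locale delta'_element = point_sequence +
  fixes \<beta> :: "int \<Rightarrow> real" and f f1 f2 :: "real \<Rightarrow> complex" and c l r :: "int \<Rightarrow> complex"
  assumes W: "W22 (range x) f f1 f2"
    and lims: "(f1 \<longlongrightarrow> c k) (at_left (x k))" "(f1 \<longlongrightarrow> c k) (at_right (x k))"
      "(f \<longlongrightarrow> l k) (at_left (x k))" "(f \<longlongrightarrow> r k) (at_right (x k))"
    and jump: "r k - l k = complex_of_real (\<beta> k) * c k"
    and sgn: "0 \<le> \<beta> k \<or> c k = 0"
begin

definition g where "g t = Re (f1 t * cnj (f t))"
definition h where "h t = Re (f2 t * cnj (f t))"

lemma h_integrable: "integrable lborel h"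
  unfolding h_def using W
  by (intro integrable_Re sq_integrable_imp_integrable_mult_cnj) (auto simp: W22_def)

lemma h_set_integrable: "set_integrable lborel {a..b} h"
  unfolding set_integrable_def using h_integrable by (intro integrable_mult_indicator) auto

lemma h_on: "h integrable_on {a..b}"
  using set_borel_integral_eq_integral(1)[OF h_set_integrable] .

text \<open>Integration by parts with the nonnegative term |f'|^2 discarded.\<close>

lemma gap_le:
  assumes ab: "a \<le> b" "x k < a" "b < x (k + 1)"
  shows "integral {a..b} h \<le> g b - g a"
proof -
  have sub: "{a..b} \<subseteq> - range x" 
  proof
    fix t assume "t \<in> {a..b}"
    then have "x k < t" "t < x (k + 1)" using ab by auto
    then show "t \<in> - range x" using in_gap[of k t] by simp
  qed
  have "((Re \<circ> (\<lambda>t. f2 t * cnj (f t) + f1 t * cnj (f1 t))) has_integral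
            Re (f1 b * cnj (f b) - f1 a * cnj (f a))) {a..b}"
    by (rule has_integral_linear[OF W22_integration_by_parts[OF W ab(1) sub] bounded_linear_Re])
  then have "((\<lambda>t. h t + (cmod (f1 t))\<^sup>2) has_integral g b - g a) {a..b}"
    by (simp add: o_def h_def g_def complex_norm_square[symmetric] del: of_real_power times_complex.sel)
  then show ?thesis
    by (rule has_integral_le[OF integrable_integral[OF h_on]]) simp
qed

lemma g_limits:
  "(g \<longlongrightarrow> Re (c k * cnj (l k))) (at_left (x k))"
  "(g \<longlongrightarrow> Re (c k * cnj (r k))) (at_right (x k))"
  unfolding g_def by (intro tendsto_intros lims)+

text \<open>The jump of \<open>g\<close> at the point is \<open>\<beta> k\<close> times |c k|^2,
  which is nonnegative by \<open>sgn\<close>. Only here do the signs of the strengths enter the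
  estimate.\<close>

lemma g_jump: "Re (c k * cnj (l k)) \<le> Re (c k * cnj (r k))"
proof -
  have r: "r k = l k + complex_of_real (\<beta> k) * c k" using jump[of k] by (simp add: algebra_simps)
  have "Re (c k * cnj (r k)) - Re (c k * cnj (l k)) = \<beta> k * (cmod (c k))\<^sup>2"
    unfolding r cmod_power2 by (simp add: algebra_simps power2_eq_square)
  also have "\<dots> \<ge> 0" using sgn[of k] by auto
  finally show ?thesis by simp
qed

text \<open>Carries the estimate across one interaction point. It is passed to the limit from the
  left and from the right; the indefinite integral is continuous there while \<open>g\<close> can
  only jump upwards. The premise \<open>le\<close> has the shape of the induction hypothesis in the
  next lemma.\<close>

lemma cross_le:
  assumes a: "a < x (k + 1)" and b: "x (k + 1) < b" "b < x (k + 1 + 1)"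
    and le: "\<And>s. x k < s \<Longrightarrow> a \<le> s \<Longrightarrow> s < x (k + 1) \<Longrightarrow> integral {a..s} h \<le> g s - g a"
  shows "integral {a..b} h \<le> g b - g a"
proof -
  define p where "p = x (k + 1)"
  let ?J = "\<lambda>s. integral {a..s} h"
  have kp: "x k < p" unfolding p_def using mono by (simp add: strict_mono_less)
  have "continuous_on {a..b} ?J" by (rule indefinite_integral_continuous_1[OF h_on])
  then have "isCont ?J p" using a b by (intro continuous_on_interior) (auto simp: p_def)
  then have J: "(?J \<longlongrightarrow> ?J p) (at_left p)" "(?J \<longlongrightarrow> ?J p) (at_right p)"
    unfolding isCont_def by (auto intro: tendsto_mono[OF at_le])
  have "?J p \<le> Re (c (k + 1) * cnj (l (k + 1))) - g a"
  proof (rule tendsto_le[OF _ _ J(1)])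
    show "((\<lambda>s. g s - g a) \<longlongrightarrow> Re (c (k + 1) * cnj (l (k + 1))) - g a) (at_left p)"
      unfolding p_def by (intro tendsto_intros g_limits)
    have "eventually (\<lambda>s. s \<in> {max a (x k)<..<p}) (at_left p)"
      by (rule eventually_at_leftI[of "max a (x k)"]) (use a kp in \<open>auto simp: p_def\<close>)
    then show "\<forall>\<^sub>F s in at_left p. ?J s \<le> g s - g a"
      by eventually_elim (use le in \<open>auto simp: p_def\<close>)
  qed simp
  moreover have "?J b - ?J p \<le> g b - Re (c (k + 1) * cnj (r (k + 1)))"
  proof (rule tendsto_le)
    show "((\<lambda>s. ?J b - ?J s) \<longlongrightarrow> ?J b - ?J p) (at_right p)" by (intro tendsto_intros J)
    show "((\<lambda>s. g b - g s) \<longlongrightarrow> g b - Re (c (k + 1) * cnj (r (k + 1)))) (at_right p)"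
      unfolding p_def by (intro tendsto_intros g_limits)
    have "eventually (\<lambda>s. s \<in> {p<..<b}) (at_right p)"
      by (rule eventually_at_rightI[of _ b]) (use b in \<open>auto simp: p_def\<close>)
    then show "\<forall>\<^sub>F s in at_right p. ?J b - ?J s \<le> g b - g s"
    proof eventually_elim
      case (elim s)
      have "?J s + integral {s..b} h = ?J b"
        by (rule Henstock_Kurzweil_Integration.integral_combine) (use elim a in \<open>auto simp: p_def h_on\<close>)
      moreover have "integral {s..b} h \<le> g b - g s"
        by (rule gap_le[of _ _ "k + 1"]) (use elim b in \<open>auto simp: p_def\<close>)
      ultimately show ?case by simp
    qed
  qed simp
  ultimately show ?thesis using g_jump[of "k + 1"] by linarith
qed

text \<open>Induction on the gap that contains the right end. Both ends lie in open gaps, since the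
  values of \<open>f\<close> and \<open>f1\<close> on the point set itself are arbitrary.\<close>

lemma integral_le:
  assumes "i \<le> j" "x i < a" "a < x (i + 1)" "x j < b" "b < x (j + 1)" "a \<le> b"
  shows "integral {a..b} h \<le> g b - g a"
  using assms(1,4-)
proof (induction j arbitrary: b rule: int_ge_induct)
  case base then show ?case using gap_le assms by blast
next
  case (step j)
  have "x (i + 1) \<le> x (j + 1)" using step.hyps mono by (simp add: strict_mono_less_eq)
  then have "a < x (j + 1)" using assms(3) by linarith
  then show ?case by (rule cross_le) (use step in auto)
qed

lemma f_square_deriv:
  assumes "x k < t" "t < x (k + 1)"
  shows "((\<lambda>t. (cmod (f t))\<^sup>2) has_real_derivative 2 * g t) (at t)"
proof -
  have "(f has_vector_derivative f1 t) (at t)"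
    using W in_gap[OF assms] by (auto simp: W22_def)
  from has_vector_derivative_mult[OF this has_vector_derivative_cnj[OF this]]
  have "((\<lambda>t. f t * cnj (f t)) has_vector_derivative f t * cnj (f1 t) + f1 t * cnj (f t)) (at t)" .
  from bounded_linear.has_vector_derivative[OF bounded_linear_Re this]
  have "((\<lambda>t. Re (f t * cnj (f t))) has_vector_derivative Re (f t * cnj (f1 t) + f1 t * cnj (f t))) (at t)" .
  moreover have "Re (f t * cnj (f1 t) + f1 t * cnj (f t)) = 2 * g t" by (simp add: g_def)
  moreover have "(\<lambda>t. Re (f t * cnj (f t))) = (\<lambda>t. (cmod (f t))\<^sup>2)"
    unfolding cmod_power2 by (simp add: power2_eq_square)
  ultimately show ?thesis by (simp add: has_real_derivative_iff_has_vector_derivative)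
qed

lemma f_square_mvt:
  assumes "x k < p" "p < q" "q < x (k + 1)"
  shows "\<exists>b. p < b \<and> b < q \<and> (cmod (f q))\<^sup>2 - (cmod (f p))\<^sup>2 = (q - p) * (2 * g b)"
  by (rule MVT2[OF assms(2)]) (use assms in \<open>auto intro!: f_square_deriv[of k]\<close>)

lemma f_square_integrable: "integrable lborel (\<lambda>t. (cmod (f t))\<^sup>2)"
  using W by (simp add: W22_def sq_integrable_def)

text \<open>The boundary term is \<open>g = (|f|\<^sup>2)' / 2\<close>. Since \<open>|f|\<^sup>2\<close> is integrable, it is small at some point of
  every far gap, so by the mean value theorem it cannot have a large derivative throughout that gap.\<close>
lemma g_small_right:
  assumes e: "0 < e"
  shows "\<exists>k\<ge>0. \<exists>b. M \<le> b \<and> x k < b \<and> b < x (k + 1) \<and> g b \<le> e"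
proof -
  have "0 < d / 2" "0 < e * d / 2" using d e by auto
  then obtain M' where M': "\<And>s. M' \<le> s \<Longrightarrow> \<exists>q\<in>{s<..<s + d / 2}. (cmod (f q))\<^sup>2 < e * d / 2"
    using tail_small_at_top[OF f_square_integrable] by (metis zero_le_power2)
  obtain k where k: "k \<ge> 0" "max M M' \<le> x k" using unbounded_above by blast
  \<comment> \<open>\<open>q\<close> lies more than d/4 to the right of x k + d/4. A slope of |f|^2
    above 2 e at the mean value point would force |f q|^2 to be at least e d / 2.\<close>
  obtain q where q: "q \<in> {x k + d / 2<..<x k + d / 2 + d / 2}" "(cmod (f q))\<^sup>2 < e * d / 2"
    using M'[of "x k + d / 2"] k d by fastforce
  have qk: "q < x (k + 1)" using q gap[of k] by simp
  obtain b where b: "x k + d / 4 < b" "b < q" "(cmod (f q))\<^sup>2 - (cmod (f (x k + d / 4)))\<^sup>2 = (q - (x k + d / 4)) * (2 * g b)"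
    using f_square_mvt[of k "x k + d / 4" q] d q qk by fastforce
  have "g b \<le> e"
  proof (rule ccontr)
    assume "\<not> ?thesis"
    then have "(d / 4) * (2 * e) \<le> (q - (x k + d / 4)) * (2 * g b)"
      using q e d by (intro mult_mono) auto
    also have "\<dots> \<le> (cmod (f q))\<^sup>2" unfolding b(3)[symmetric] by simp
    finally show False using q(2) by (simp add: algebra_simps)
  qed
  then show ?thesis using k b d qk by (intro exI[of _ k] conjI exI[of _ b]) auto
qed

text \<open>The final estimate involves g b - g a, so the left end needs the opposite one-sided
  bound. The small value of |f|^2 now sits to the left of the comparison point, and a steep decrease
  between them would contradict it.\<close>

lemma g_small_left:
  assumes e: "0 < e"
  shows "\<exists>k\<le>0. \<exists>a. a \<le> M \<and> x k < a \<and> a < x (k + 1) \<and> - e \<le> g a"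
proof -
  have "0 < d / 2" "0 < e * d / 2" using d e by auto
  then obtain M' where M': "\<And>s. s \<le> M' \<Longrightarrow> \<exists>q\<in>{s<..<s + d / 2}. (cmod (f q))\<^sup>2 < e * d / 2"
    using tail_small_at_bot[OF f_square_integrable] by (metis zero_le_power2)
  \<comment> \<open>The point found later lies below x k + 3 d / 4; the margin \<open>d\<close>
    keeps it below \<open>M\<close>.\<close>
  obtain k where k: "k \<le> 0" "x k \<le> min (M - d) M'" using unbounded_below by blast
  obtain q where q: "q \<in> {x k<..<x k + d / 2}" "(cmod (f q))\<^sup>2 < e * d / 2"
    using M'[of "x k"] k d by fastforce
  let ?p = "x k + 3 * d / 4"
  have pk: "?p < x (k + 1)" using d gap[of k] by simp
  obtain a where a: "q < a" "a < ?p" "(cmod (f ?p))\<^sup>2 - (cmod (f q))\<^sup>2 = (?p - q) * (2 * g a)"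
    using f_square_mvt[of k q ?p] d q pk by fastforce
  have "- e \<le> g a"
  proof (rule ccontr)
    assume "\<not> ?thesis"
    then have "(d / 4) * (2 * e) \<le> (?p - q) * (2 * - g a)"
      using q e d by (intro mult_mono) auto
    also have "\<dots> = (cmod (f q))\<^sup>2 - (cmod (f ?p))\<^sup>2" using a(3) by (simp add: algebra_simps)
    also have "\<dots> \<le> (cmod (f q))\<^sup>2" by simp
    finally show False using q(2) by (simp add: algebra_simps)
  qed
  then show ?thesis using k a d pk q by (intro exI[of _ k] conjI exI[of _ a]) auto
qed

lemma integral_h_nonpos: "integral\<^sup>L lborel h \<le> 0"
proof (rule field_le_epsilon)
  fix e :: real assume "0 < e"
  then have e: "0 < e / 2" by simp
  have "\<exists>a b. a \<le> - real n \<and> real n \<le> b \<and> integral {a..b} h \<le> e" for n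
  proof -
    \<comment> \<open>Comparing both ends with \<open>x 1\<close> gives a \<le> b, and the signs of
      the indices give i \<le> j, as \<open>integral_le\<close> requires.\<close>
    obtain j b where b: "j \<ge> 0" "max (real n) (x 1) \<le> b" "x j < b" "b < x (j + 1)" "g b \<le> e / 2"
      using g_small_right[OF e] by blast
    obtain i a where a: "i \<le> 0" "a \<le> min (- real n) (x 1)" "x i < a" "a < x (i + 1)" "- (e / 2) \<le> g a"
      using g_small_left[OF e] by blast
    have "integral {a..b} h \<le> g b - g a" using a b by (intro integral_le[of i j]) auto
    then show ?thesis using a b by (intro exI[of _ a] exI[of _ b]) auto
  qed
  then obtain A B where AB: "\<And>n. A n \<le> - real n" "\<And>n. real n \<le> B n" "\<And>n. integral {A n..B n} h \<le> e"
    by metis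
  have [measurable]: "h \<in> borel_measurable borel" using h_integrable by auto
  have "(\<lambda>n. \<integral>t. indicator {A n..B n} t *\<^sub>R h t \<partial>lborel) \<longlonglongrightarrow> integral\<^sup>L lborel h"
  proof (rule integral_dominated_convergence[where w = "\<lambda>t. norm (h t)"])
    show "AE t in lborel. (\<lambda>n. indicator {A n..B n} t *\<^sub>R h t) \<longlonglongrightarrow> h t"
    proof (rule AE_I2, rule tendsto_eventually)
      fix t :: real
      obtain N :: nat where N: "\<bar>t\<bar> \<le> real N" using real_arch_simple by blast
      show "\<forall>\<^sub>F n in sequentially. indicator {A n..B n} t *\<^sub>R h t = h t"
      proof (rule eventually_sequentiallyI[of N])
        fix n assume "N \<le> n"
        then have "\<bar>t\<bar> \<le> real n" using N by linarith
        then have "t \<in> {A n..B n}" using AB(1,2)[of n] by auto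
        then show "indicator {A n..B n} t *\<^sub>R h t = h t" by simp
      qed
    qed
  qed (use h_integrable in \<open>auto simp: indicator_def\<close>)
  moreover have "(\<integral>t. indicator {A n..B n} t *\<^sub>R h t \<partial>lborel) \<le> e" for n
    using set_borel_integral_eq_integral(2)[OF h_set_integrable, of "A n" "B n"] AB(3)[of n]
    by (simp add: set_lebesgue_integral_def)
  ultimately show "integral\<^sup>L lborel h \<le> 0 + e" by (intro LIMSEQ_le_const2) auto
qed

end

section \<open>Spectral measures and dimension counting\<close>

lemma L2_rel_refl: "sq_integrable f \<Longrightarrow> L2_rel f f"
  by (simp add: L2_rel_def)

lemma cinner_abs_L2:
  "sq_integrable f \<Longrightarrow> sq_integrable g \<Longrightarrow> cinner_L2 (abs_L2 f) (abs_L2 g) = (\<integral>t. f t * cnj (g t) \<partial>lborel)"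
  by (simp add: cinner_L2.abs_eq L2_rel_refl)

lemma abs_L2_add:
  "sq_integrable f \<Longrightarrow> sq_integrable g \<Longrightarrow> abs_L2 f + abs_L2 g = abs_L2 (\<lambda>t. f t + g t)"
  by (simp add: plus_L2.abs_eq L2_rel_refl)

lemma abs_L2_scale: "sq_integrable f \<Longrightarrow> scaleC_L2 c (abs_L2 f) = abs_L2 (\<lambda>t. c * f t)"
  by (simp add: scaleC_L2.abs_eq L2_rel_refl)

lemma cinner_L2_commute: "cinner_L2 f g = cnj (cinner_L2 g f)"
  by transfer (simp add: mult.commute flip: Bochner_Integration.integral_cnj)

lemma cinner_L2_add_left: "cinner_L2 (f + g) h = cinner_L2 f h + cinner_L2 g h"
  by transfer (auto simp: L2_rel_def distrib_right
        intro!: Bochner_Integration.integral_add sq_integrable_imp_integrable_mult_cnj)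

lemma cinner_L2_scale_left: "cinner_L2 (scaleC_L2 c f) g = c * cinner_L2 f g"
  by transfer (simp add: mult.assoc)

lemma cinner_L2_add_right: "cinner_L2 h (f + g) = cinner_L2 h f + cinner_L2 h g"
  by (metis cinner_L2_add_left cinner_L2_commute complex_cnj_add)

lemma cinner_L2_scale_right: "cinner_L2 f (scaleC_L2 c g) = cnj c * cinner_L2 f g"
  by (metis cinner_L2_scale_left cinner_L2_commute complex_cnj_mult)

lemma cinner_L2_zero_left: "cinner_L2 0 g = 0"
  using cinner_L2_scale_left[of 0 0 g] by simp

lemma cinner_L2_zero_right: "cinner_L2 g 0 = 0"
  by (subst cinner_L2_commute) (simp add: cinner_L2_zero_left)

lemma cinner_L2_sum_left: "cinner_L2 (\<Sum>k\<in>K. f k) h = (\<Sum>k\<in>K. cinner_L2 (f k) h)"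
  by (induction K rule: infinite_finite_induct) (auto simp: cinner_L2_add_left cinner_L2_zero_left)

lemma cinner_L2_sum_right: "cinner_L2 h (\<Sum>k\<in>K. f k) = (\<Sum>k\<in>K. cinner_L2 h (f k))"
  by (induction K rule: infinite_finite_induct) (auto simp: cinner_L2_add_right cinner_L2_zero_right)

lemma orth_projection_linear:
  assumes "orth_projection P"
  shows "P (f + g) = P f + P g" "P (scaleC_L2 c f) = scaleC_L2 c (P f)" "P 0 = 0"
proof -
  have l: "Vector_Spaces.linear scaleC_L2 scaleC_L2 P" using assms by (simp add: orth_projection_def)
  show "P (f + g) = P f + P g" "P (scaleC_L2 c f) = scaleC_L2 c (P f)"
    using l by (auto simp: Vector_Spaces.linear_iff)
  show "P 0 = 0" using l by (metis L2.scale_zero_left Vector_Spaces.linear_iff)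
qed

lemma orth_projection_sum:
  assumes "orth_projection P" shows "P (\<Sum>k\<in>K. f k) = (\<Sum>k\<in>K. P (f k))"
  by (induction K rule: infinite_finite_induct) (auto simp: orth_projection_linear[OF assms])

lemma inner_orth_projection:
  assumes "orth_projection P" shows "inner (P f) f = (norm (P f))\<^sup>2"
proof -
  have "cinner_L2 (P f) f = cinner_L2 (P f) (P f)"
    using assms unfolding orth_projection_def by metis
  then have "inner (P f) f = inner (P f) (P f)" by (simp add: inner_L2_def)
  then show ?thesis by (simp add: power2_norm_eq_inner)
qed

lemma subspace_range_orth_projection:
  assumes "orth_projection P" shows "L2.subspace (range P)"
  unfolding L2.subspace_def
  using orth_projection_linear[OF assms] by (metis (no_types, lifting) rangeE rangeI)

section \<open>Calculus of projection-valued measures and their scalar measures\<close>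

locale pvm =
  fixes E assumes pvm: "projection_valued_measure E"
begin

lemma proj: "B \<in> sets borel \<Longrightarrow> orth_projection (E B)"
  using pvm by (simp add: projection_valued_measure_def)

lemma UNIV: "E UNIV f = f"
  using pvm by (simp add: projection_valued_measure_def)

lemma sums:
  assumes "range B \<subseteq> sets borel" "disjoint_family B"
  shows "(\<lambda>n. E (B n) f) sums E (\<Union>n. B n) f"
  using pvm assms unfolding projection_valued_measure_def by blast

text \<open>Countable additivity on the constant empty family makes a constant series
  converge.\<close>

lemma empty: "E {} f = 0"
proof -
  have "(\<lambda>n. E ((\<lambda>_::nat. {}) n) f) sums E (\<Union>n::nat. {}) f"
    by (rule sums) (auto simp: disjoint_family_on_def)
  then have "(\<lambda>n::nat. E {} f) \<longlonglongrightarrow> 0" by (intro summable_LIMSEQ_zero) (auto simp: sums_iff)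
  then show ?thesis by (simp add: LIMSEQ_const_iff)
qed

lemma Un:
  assumes "A \<in> sets borel" "B \<in> sets borel" "A \<inter> B = {}"
  shows "E (A \<union> B) f = E A f + E B f"
proof -
  define C :: "nat \<Rightarrow> real set" where "C n = (if n = 0 then A else if n = 1 then B else {})" for n
  have "(\<lambda>n. E (C n) f) sums E (\<Union>n. C n) f"
    by (rule sums) (use assms in \<open>auto simp: disjoint_family_on_def C_def\<close>)
  moreover have "(\<Union>n. C n) = A \<union> B"
  proof -
    have "C 0 = A" "C 1 = B" "\<And>n. C n \<subseteq> A \<union> B" by (auto simp: C_def)
    then show ?thesis by blast
  qed
  moreover have "(\<lambda>n. E (C n) f) sums (\<Sum>n\<in>{0,1}. E (C n) f)"
    by (rule sums_finite) (auto simp: C_def empty)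
  ultimately have "E (A \<union> B) f = (\<Sum>n\<in>{0,1}. E (C n) f)" by (metis sums_unique2)
  then show ?thesis by (simp add: C_def)
qed

text \<open>Multiplicativity is not among the defining conditions and is derived from additivity.
  For f = E A v one has |E (A Un B) f|^2 = |f|^2 + |E B f|^2, while a projection cannot increase the
  norm.\<close>

lemma orthogonal:
  assumes A: "A \<in> sets borel" and B: "B \<in> sets borel" and AB: "A \<inter> B = {}"
  shows "E B (E A v) = 0"
proof -
  let ?f = "E A v"
  have PA: "E A ?f = ?f" using proj[OF A] by (simp add: orth_projection_def)
  have U: "orth_projection (E (A \<union> B))" using A B by (intro proj) auto
  have eq: "(norm (E (A \<union> B) ?f))\<^sup>2 = (norm ?f)\<^sup>2 + (norm (E B ?f))\<^sup>2"
  proof -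
    have "(norm (E (A \<union> B) ?f))\<^sup>2 = inner (?f + E B ?f) ?f"
      using inner_orth_projection[OF U, of ?f] by (simp add: Un[OF A B AB] PA)
    also have "\<dots> = (norm ?f)\<^sup>2 + (norm (E B ?f))\<^sup>2"
      using inner_orth_projection[OF proj[OF B], of ?f] by (simp add: inner_add_left power2_norm_eq_inner)
    finally show ?thesis .
  qed
  have "(norm (E (A \<union> B) ?f))\<^sup>2 \<le> norm (E (A \<union> B) ?f) * norm ?f"
    unfolding inner_orth_projection[OF U, symmetric] by (rule norm_cauchy_schwarz)
  then have "norm (E (A \<union> B) ?f) \<le> norm ?f"
    by (cases "norm (E (A \<union> B) ?f) = 0") (auto simp: power2_eq_square)
  then have "(norm (E (A \<union> B) ?f))\<^sup>2 \<le> (norm ?f)\<^sup>2" by (intro power_mono) auto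
  then show ?thesis using eq by (smt (verit) norm_eq_zero zero_le_power2 power2_eq_iff_nonneg power_eq_0_iff)
qed

lemma mono:
  assumes A: "A \<in> sets borel" and B: "B \<in> sets borel" and AB: "A \<subseteq> B"
  shows "E A (E B v) = E A v" "E B (E A v) = E A v"
proof -
  have eq: "E B f = E A f + E (B - A) f" for f
    using Un[of A "B - A" f] A B AB by (simp add: Un_absorb1)
  have "E A (E (B - A) v) = 0" "E (B - A) (E A v) = 0"
    using orthogonal[of A "B - A" v] orthogonal[of "B - A" A v] A B by auto
  moreover have "E A (E A v) = E A v" using proj[OF A] by (simp add: orth_projection_def)
  ultimately show "E A (E B v) = E A v" "E B (E A v) = E A v"
    unfolding eq by (simp_all add: orth_projection_linear[OF proj[OF A]])
qed

lemma shows space_mu: "space (scalar_spectral_measure E f) = UNIV"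
  and sets_mu: "sets (scalar_spectral_measure E f) = sets borel"
  and emeasure_mu: "B \<in> sets borel \<Longrightarrow> emeasure (scalar_spectral_measure E f) B = ennreal (inner (E B f) f)"
proof -
  have sig: "sigma_algebra UNIV (sets (borel :: real measure))" by (metis sets.sigma_algebra_axioms space_borel)
  show "space (scalar_spectral_measure E f) = UNIV" unfolding scalar_spectral_measure_def by (rule space_measure_of) auto
  show sets: "sets (scalar_spectral_measure E f) = sets borel" unfolding scalar_spectral_measure_def
    using sig by (metis sigma_algebra.sets_measure_of_eq)
  assume B: "B \<in> sets borel"
  show "emeasure (scalar_spectral_measure E f) B = ennreal (inner (E B f) f)"
  proof (rule emeasure_measure_of[OF scalar_spectral_measure_def])
    show "positive (sets (scalar_spectral_measure E f)) (\<lambda>B. ennreal (inner (E B f) f))"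
      by (simp add: positive_def empty)
    show "countably_additive (sets (scalar_spectral_measure E f)) (\<lambda>B. ennreal (inner (E B f) f))"
      unfolding countably_additive_def sets
    proof (intro allI impI)
      fix A :: "nat \<Rightarrow> real set" assume A: "range A \<subseteq> sets borel" "disjoint_family A"
      have "(\<lambda>n. inner (E (A n) f) f) sums inner (E (\<Union>n. A n) f) f"
        using bounded_linear.sums[OF bounded_linear_inner_left sums[OF A]] .
      moreover have "0 \<le> inner (E (A n) f) f" for n
        using A by (subst inner_orth_projection) (auto intro: proj)
      ultimately show "(\<Sum>n. ennreal (inner (E (A n) f) f)) = ennreal (inner (E (\<Union>n. A n) f) f)"
        by (metis suminf_ennreal_eq)
    qed
  qed (use B sets in auto)
qed

lemma AE_mu:
  assumes A: "A \<in> sets borel" and 0: "E (- A) f = 0"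
  shows "AE s in scalar_spectral_measure E f. s \<in> A"
proof (rule AE_I[of _ _ "- A"])
  show "emeasure (scalar_spectral_measure E f) (- A) = 0"
    using A 0 by (subst emeasure_mu) (auto simp: Compl_eq_Diff_UNIV)
qed (use A in \<open>auto simp: sets_mu space_mu Compl_eq_Diff_UNIV\<close>)

text \<open>The measure lives on [0, oo). If the identity is not integrable, the Bochner integral is
  0 and the bound still holds.\<close>

lemma integral_mu_nonneg:
  assumes "E {..<0} f = 0"
  shows "0 \<le> (\<integral>s. s \<partial>scalar_spectral_measure E f)"
  using AE_mu[of "{0..}" f] assms by (intro integral_nonneg_AE) (simp add: Compl_atLeast)

lemma finite_mu: "finite_measure (scalar_spectral_measure E f)"
  by (rule finite_measureI) (simp add: space_mu emeasure_mu)

text \<open>The scalar measure of such a vector is finite and carried by the bounded set [-r, 0):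
  boundedness puts the vector into the domain, and for a nonzero vector the total mass |f|^2 is
  positive while the integrand is strictly negative.\<close>

lemma fixed_mu:
  assumes f: "E {-r..<0} f = f"
  shows integrable_mu: "integrable (scalar_spectral_measure E f) (\<lambda>s. s\<^sup>2)"
    and integral_mu_neg: "f \<noteq> 0 \<Longrightarrow> (\<integral>s. s \<partial>scalar_spectral_measure E f) < 0"
proof -
  let ?M = "scalar_spectral_measure E f"
  have meas: "h \<in> borel_measurable ?M" if "h \<in> borel_measurable borel" for h :: "real \<Rightarrow> real"
    using that by (simp add: sets_mu cong: measurable_cong_sets)
  have "E (- {-r..<0}) f = 0"
    using orthogonal[of "{-r..<0}" "- {-r..<0}" f] f by (simp add: Compl_eq_Diff_UNIV)
  then have ae: "AE s in ?M. s \<in> {-r..<0}" by (intro AE_mu) auto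
  show "integrable ?M (\<lambda>s. s\<^sup>2)"
  proof (intro finite_measure.integrable_const_bound[OF finite_mu, of _ "r\<^sup>2"] meas)
    show "AE s in ?M. norm (s\<^sup>2) \<le> r\<^sup>2"
      using ae by eventually_elim (auto simp: abs_le_square_iff[symmetric])
  qed measurable
  have int: "integrable ?M (\<lambda>s. s)"
  proof (intro finite_measure.integrable_const_bound[OF finite_mu, of _ "\<bar>r\<bar>"] meas)
    show "AE s in ?M. norm s \<le> \<bar>r\<bar>"
      using ae by eventually_elim auto
  qed measurable
  assume nz: "f \<noteq> 0"
  show "(\<integral>s. s \<partial>?M) < 0"
  proof (rule ccontr)
    assume "\<not> ?thesis"
    moreover have nn: "AE s in ?M. 0 \<le> - s" using ae by eventually_elim auto
    then have "0 \<le> (\<integral>s. - s \<partial>?M)" by (rule integral_nonneg_AE)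
    ultimately have "(\<integral>s. - s \<partial>?M) = 0" by simp
    then have "AE s in ?M. - s = 0"
      using nn int by (subst (asm) integral_nonneg_eq_0_iff_AE) auto
    with ae have "AE s in ?M. False" by eventually_elim auto
    then have "emeasure ?M (space ?M) = 0" by (subst (asm) AE_iff_measurable[of "space ?M"]) auto
    then have "ennreal (inner f f) = 0" by (simp add: space_mu emeasure_mu UNIV)
    then show False using nz by simp
  qed
qed

text \<open>The truncations are the partial sums for the partition of the negative half-line into
  unit intervals.\<close>

lemma tendsto_truncation: "(\<lambda>n. E {-real n..<0} v) \<longlonglongrightarrow> E {..<0} v"
proof -
  define C where "C n = {- real (Suc n)..<- real n}" for n
  have disj: "disjoint_family C"
    unfolding disjoint_family_on_def C_def
  proof (intro ballI impI)
    fix i j :: nat assume "i \<noteq> j"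
    then consider "real (Suc i) \<le> real j" | "real (Suc j) \<le> real i" by linarith
    then show "{- real (Suc i)..<- real i} \<inter> {- real (Suc j)..<- real j} = {}" by cases auto
  qed
  have UnC: "(\<Union>n. C n) = {..<0}"
  proof (intro equalityI subsetI)
    fix s :: real assume "s \<in> {..<0}"
    \<comment> \<open>The pieces are closed on the left, so s = -m belongs to piece m - 1; the
      ceiling yields this index.\<close>
    then have "s \<in> C (nat (\<lceil>-s\<rceil> - 1))" unfolding C_def by (simp add: of_nat_diff) linarith
    then show "s \<in> (\<Union>n. C n)" by blast
  qed (auto simp: C_def)
  have part: "E {-real n..<0} v = (\<Sum>i<n. E (C i) v)" for n
  proof (induction n)
    case 0 then show ?case by (simp add: empty)
  next
    case (Suc n)
    have "{-real (Suc n)..<0} = {-real n..<0} \<union> C n" by (auto simp: C_def)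
    moreover have "{-real n..<0} \<inter> C n = {}" by (auto simp: C_def)
    ultimately show ?case using Un[of "{-real n..<0}" "C n" v] Suc by (simp add: C_def)
  qed
  have "(\<lambda>n. E (C n) v) sums E {..<0} v"
  proof -
    have "range C \<subseteq> sets borel" by (auto simp: C_def)
    from sums[OF this disj, of v] show ?thesis unfolding UnC .
  qed
  then show ?thesis unfolding part sums_def .
qed

end

text \<open>A space on which finitely many functionals have trivial common kernel has at most that
  many dimensions. It is phrased for a linear relation because boundary values are attached to
  representatives rather than to L2 classes. The induction is elimination: an element with nonzero
  k-th value serves as pivot, and subtracting multiples of it lands in the part where that value
  vanishes.\<close>

lemma span_of_kernel_condition:
  fixes R :: "(L2 \<times> ('i \<Rightarrow> complex)) set"
  assumes "finite K"
    and "\<And>f c g d a. (f, c) \<in> R \<Longrightarrow> (g, d) \<in> R \<Longrightarrow> (f - scaleC_L2 a g, \<lambda>i. c i - a * d i) \<in> R"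
    and "\<And>f c. (f, c) \<in> R \<Longrightarrow> (\<forall>k\<in>K. c k = 0) \<Longrightarrow> f = 0"
  shows "\<exists>B. finite B \<and> card B \<le> card K \<and> fst ` R \<subseteq> L2.span B"
  using assms
proof (induction K arbitrary: R rule: finite_induct)
  case empty
  then have "fst ` R \<subseteq> L2.span {}" by (auto simp: L2.span_empty)
  then show ?case by (intro exI[of _ "{}"]) auto
next
  case (insert k K R)
  define R' where "R' = {(f, c) \<in> R. c k = 0}"
  have "\<exists>B. finite B \<and> card B \<le> card K \<and> fst ` R' \<subseteq> L2.span B"
    by (rule insert.IH) (use insert.prems in \<open>auto simp: R'_def\<close>)
  then obtain B where B: "finite B" "card B \<le> card K" "fst ` R' \<subseteq> L2.span B" by blast
  show ?case
  proof (cases "R' = R")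
    case True
    then show ?thesis using B insert.hyps by (intro exI[of _ B]) auto
  next
    case False
    then obtain f0 c0 where 0: "(f0, c0) \<in> R" "c0 k \<noteq> 0" by (auto simp: R'_def)
    have "f \<in> L2.span (insert f0 B)" if f: "(f, c) \<in> R" for f c
    proof -
      have "(f - scaleC_L2 (c k / c0 k) f0, \<lambda>i. c i - (c k / c0 k) * c0 i) \<in> R'"
        unfolding R'_def using insert.prems(1)[OF f 0(1), of "c k / c0 k"] 0(2) by auto
      then have "f - scaleC_L2 (c k / c0 k) f0 \<in> L2.span B" using B(3) by force
      then show ?thesis using L2.span_breakdown_eq by blast
    qed
    then have "fst ` R \<subseteq> L2.span (insert f0 B)" by auto
    moreover have "card (insert f0 B) \<le> card (insert k K)"
      using B insert.hyps by (simp add: card_insert_if)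
    ultimately show ?thesis using B(1) by (intro exI[of _ "insert f0 B"]) auto
  qed
qed

text \<open>The union \<open>W\<close> of the ranges of \<open>E [-n, 0)\<close> lies in the domain of \<open>T\<close> and carries a negative form,
  hence embeds into the boundary values on \<open>K\<close>. Being finite-dimensional, \<open>W\<close> is already one of
  these ranges, and therefore equals the range of \<open>E (-\<infinity>, 0)\<close>.\<close>
lemma negative_squares_le:
  fixes G :: "(L2 \<times> L2 \<times> ('i \<Rightarrow> complex)) set"
  assumes E: "is_spectral_measure_of E T" and K: "finite K"
    and cov: "\<And>f u. (f, u) \<in> T \<Longrightarrow> \<exists>v c. (f, v, c) \<in> G"
    and diff: "\<And>f u c g v d a. (f, u, c) \<in> G \<Longrightarrow> (g, v, d) \<in> G
          \<Longrightarrow> (f - scaleC_L2 a g, u - scaleC_L2 a v, \<lambda>i. c i - a * d i) \<in> G"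
    and nonneg: "\<And>f u c. (f, u, c) \<in> G \<Longrightarrow> \<forall>k\<in>K. c k = 0 \<Longrightarrow> (f, u) \<in> T \<and> 0 \<le> Re (cinner_L2 u f)"
  shows "negative_squares E \<le> enat (card K)"
proof -
  interpret pvm E using E by unfold_locales (simp add: is_spectral_measure_of_def)
  let ?P = "\<lambda>n::nat. E {-real n..<0}"
  define W where "W = (\<Union>n. range (?P n))"
  have fixW: "?P m f = f" if "f \<in> range (?P n)" "n \<le> m" for f n m
    using that mono(2)[of "{-real n..<0}" "{-real m..<0}"] by auto
  have subn: "L2.subspace (range (?P n))" for n
    by (intro subspace_range_orth_projection proj) auto
  have monoW: "range (?P n) \<subseteq> range (?P m)" if "n \<le> m" for n m
    using fixW[OF _ that] by (metis rangeI subsetI)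
  define R where "R = {(f, c). f \<in> W \<and> (\<exists>u. (f, u, c) \<in> G)}"
  have WT: "\<exists>u. (f, u) \<in> T" if "f \<in> W" for f
  proof -
    from that obtain n where "f \<in> range (?P n)" by (auto simp: W_def)
    then have "integrable (scalar_spectral_measure E f) (\<lambda>s. s\<^sup>2)" using fixW integrable_mu by blast
    moreover have "Domain T = {f. integrable (scalar_spectral_measure E f) (\<lambda>s. s\<^sup>2)}"
      using E unfolding is_spectral_measure_of_def by blast
    ultimately show ?thesis by blast
  qed
  have "\<exists>B. finite B \<and> card B \<le> card K \<and> fst ` R \<subseteq> L2.span B"
  proof (rule span_of_kernel_condition[OF K])
    fix f c g d a assume fg: "(f, c) \<in> R" "(g, d) \<in> R"
    then obtain n m where "f \<in> range (?P n)" "g \<in> range (?P m)" by (auto simp: R_def W_def)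
    then have "f \<in> range (?P (max n m))" "g \<in> range (?P (max n m))"
      using monoW[of n "max n m"] monoW[of m "max n m"] by auto
    then have "f - scaleC_L2 a g \<in> range (?P (max n m))"
      using subn[of "max n m"] L2.subspace_diff L2.subspace_scale by blast
    then show "(f - scaleC_L2 a g, \<lambda>i. c i - a * d i) \<in> R"
      using fg diff unfolding R_def W_def by blast
  next
    fix f c assume fc: "(f, c) \<in> R" "\<forall>k\<in>K. c k = 0"
    then obtain u n where u: "(f, u, c) \<in> G" and n: "f \<in> range (?P n)" by (auto simp: R_def W_def)
    from nonneg[OF u fc(2)] have u: "(f, u) \<in> T" "0 \<le> Re (cinner_L2 u f)" by auto
    then have "0 \<le> (\<integral>s. s \<partial>scalar_spectral_measure E f)" using E by (auto simp: is_spectral_measure_of_def)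
    then show "f = 0" using integral_mu_neg[OF fixW[OF n order.refl]] by force
  qed
  moreover have "W \<subseteq> fst ` R" using WT cov by (force simp: R_def)
  ultimately obtain B where B: "finite B" "card B \<le> card K" "W \<subseteq> L2.span B" by blast
  obtain D where D: "D \<subseteq> W" "L2.independent D" "W \<subseteq> L2.span D"
    using L2.maximal_independent_subset by blast
  have "finite D" using L2.independent_span_bound[OF B(1) D(2)] D(1) B(3) by blast
  then have "\<exists>n. D \<subseteq> range (?P n)" using D(1)
  proof (induction D rule: finite_induct)
    case (insert f D)
    then obtain n m where "D \<subseteq> range (?P n)" "f \<in> range (?P m)" by (auto simp: W_def)
    then show ?case using monoW[of n "max n m"] monoW[of m "max n m"] by (intro exI[of _ "max n m"]) auto
  qed simp
  then obtain n where n: "D \<subseteq> range (?P n)" by blast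
  then have Wn: "W \<subseteq> range (?P n)" using D(3) L2.span_minimal[OF n subn] by blast
  have V: "range (E {..<0}) \<subseteq> W"
  proof
    fix f assume "f \<in> range (E {..<0})"
    then obtain v where v: "f = E {..<0} v" by blast
    \<comment> \<open>\<open>?P m v\<close> lies in the range of \<open>?P n\<close> and is fixed by
      it, whereas \<open>?P n\<close> composed with \<open>?P m\<close> is \<open>?P n\<close>. So
      the truncations are eventually constant and equal their limit.\<close>
    have "?P m v = ?P n v" if "n \<le> m" for m
    proof -
      have "?P m v \<in> range (?P n)" using Wn unfolding W_def by blast
      then have "?P n (?P m v) = ?P m v" using fixW by blast
      then show ?thesis using mono(1)[of "{-real n..<0}" "{-real m..<0}" v] that by simp
    qed
    then have "\<forall>\<^sub>F m in sequentially. ?P m v = ?P n v" by (rule eventually_sequentiallyI)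
    then have "(\<lambda>m. ?P m v) \<longlonglongrightarrow> ?P n v" by (rule tendsto_eventually)
    with tendsto_truncation[of v] have "f = ?P n v" unfolding v using LIMSEQ_unique by blast
    then show "f \<in> W" by (auto simp: W_def)
  qed
  have "range (E {..<0}) \<subseteq> L2.span B" using V B(3) by blast
  moreover from this have "L2.dim (range (E {..<0})) \<le> card K"
    using L2.dim_le_card B by (meson order.trans)
  ultimately show ?thesis using B(1) by (auto simp: negative_squares_def edim_L2_def)
qed

lemma linear_graph_sum:
  assumes T: "linear_graph T" and "\<And>k. k \<in> K \<Longrightarrow> (g k, u k) \<in> T"
  shows "((\<Sum>k\<in>K. scaleC_L2 (a k) (g k)), (\<Sum>k\<in>K. scaleC_L2 (a k) (u k))) \<in> T"
  using assms(2)
proof (induction K rule: infinite_finite_induct)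
  case (insert k K)
  then have "(g k, u k) \<in> T" by simp
  then have "(scaleC_L2 (a k) (g k), scaleC_L2 (a k) (u k)) \<in> T" using T unfolding linear_graph_def by blast
  with insert T show ?case unfolding linear_graph_def by fastforce
qed (use T in \<open>auto simp: linear_graph_def\<close>)

text \<open>If a nontrivial combination of the projected vectors vanished, the same combination of
  the \<open>g k\<close> would be annihilated by E(-oo, 0) and have a nonnegative form, against
  \<open>neg\<close>. So the projected vectors are independent.\<close>

lemma negative_squares_ge:
  fixes g u :: "'i \<Rightarrow> L2"
  assumes E: "is_spectral_measure_of E T" and K: "finite K"
    and gu: "\<And>k. k \<in> K \<Longrightarrow> (g k, u k) \<in> T"
    and neg: "\<And>a. \<exists>k\<in>K. a k \<noteq> 0 \<Longrightarrow>
       Re (cinner_L2 (\<Sum>k\<in>K. scaleC_L2 (a k) (u k)) (\<Sum>k\<in>K. scaleC_L2 (a k) (g k))) < 0"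
  shows "enat (card K) \<le> negative_squares E"
proof -
  interpret pvm E using E by unfold_locales (simp add: is_spectral_measure_of_def)
  let ?P = "E {..<0}"
  have P: "orth_projection ?P" by (intro proj) auto
  have nz: "(\<Sum>k\<in>K. scaleC_L2 (a k) (?P (g k))) \<noteq> 0" if "\<exists>k\<in>K. a k \<noteq> 0" for a
  proof
    let ?f = "\<Sum>k\<in>K. scaleC_L2 (a k) (g k)" let ?u = "\<Sum>k\<in>K. scaleC_L2 (a k) (u k)"
    assume "(\<Sum>k\<in>K. scaleC_L2 (a k) (?P (g k))) = 0"
    then have "?P ?f = 0" by (simp add: orth_projection_sum[OF P] orth_projection_linear[OF P])
    then have "0 \<le> (\<integral>s. s \<partial>scalar_spectral_measure E ?f)" by (rule integral_mu_nonneg)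
    moreover have "(?f, ?u) \<in> T" using E gu by (intro linear_graph_sum) (unfold is_spectral_measure_of_def, blast+)
    then have "cinner_L2 ?u ?f = complex_of_real (\<integral>s. s \<partial>scalar_spectral_measure E ?f)"
      using E by (auto simp: is_spectral_measure_of_def)
    ultimately have "0 \<le> Re (cinner_L2 ?u ?f)" by simp
    with neg[OF that] show False by simp
  qed
  \<comment> \<open>Independence concerns the image as a set, so coinciding vectors must be excluded
    separately, by the coefficients 1 and -1.\<close>
  have inj: "inj_on (\<lambda>k. ?P (g k)) K"
  proof (rule inj_onI, rule ccontr)
    fix k l assume kl: "k \<in> K" "l \<in> K" "?P (g k) = ?P (g l)" "k \<noteq> l"
    define a :: "'i \<Rightarrow> complex" where "a i = (if i = k then 1 else 0) + (if i = l then -1 else 0)" for i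
    have "(\<Sum>i\<in>K. scaleC_L2 (a i) (?P (g i)))
        = (\<Sum>i\<in>K. if i = k then ?P (g i) else 0) + (\<Sum>i\<in>K. if i = l then - ?P (g i) else 0)"
      unfolding sum.distrib[symmetric] a_def using kl(4) by (intro sum.cong) (auto simp: L2.scale_left_distrib)
    also have "\<dots> = 0" using kl K by simp
    finally have "(\<Sum>i\<in>K. scaleC_L2 (a i) (?P (g i))) = 0" .
    moreover have "a k \<noteq> 0" using kl(4) by (simp add: a_def)
    ultimately show False using nz[of a] kl(1) by blast
  qed
  have "\<not> L2.dependent ((\<lambda>k. ?P (g k)) ` K)"
  proof
    assume "L2.dependent ((\<lambda>k. ?P (g k)) ` K)"
    then obtain c where c: "\<exists>v\<in>(\<lambda>k. ?P (g k)) ` K. c v \<noteq> 0"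
        "(\<Sum>v\<in>(\<lambda>k. ?P (g k)) ` K. scaleC_L2 (c v) v) = 0"
      using K by (subst (asm) L2.dependent_finite) auto
    then show False using nz[of "\<lambda>k. c (?P (g k))"] by (auto simp: sum.reindex[OF inj])
  qed
  then have ind: "L2.independent ((\<lambda>k. ?P (g k)) ` K)" .
  have cardK: "card ((\<lambda>k. ?P (g k)) ` K) = card K" by (rule card_image[OF inj])
  show ?thesis
  proof (cases "\<exists>B. finite B \<and> range ?P \<subseteq> L2.span B")
    case False
    then show ?thesis unfolding negative_squares_def edim_L2_def by (subst if_not_P) auto
  next
    case True
    then obtain B where B: "finite B" "range ?P \<subseteq> L2.span B" by blast
    obtain D where D: "D \<subseteq> range ?P" "L2.independent D" "range ?P \<subseteq> L2.span D"
      using L2.maximal_independent_subset by blast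
    have "finite D" using L2.independent_span_bound[OF B(1) D(2)] D(1) B(2) by blast
    then have "card ((\<lambda>k. ?P (g k)) ` K) \<le> card D"
      using L2.independent_span_bound[OF _ ind, of D] D(3) by blast
    also have "card D = L2.dim (range ?P)" by (rule L2.basis_card_eq_dim[OF D(1) D(3) D(2)])
    finally show ?thesis using True cardK unfolding negative_squares_def edim_L2_def by (subst if_P) auto
  qed
qed

section \<open>Test functions\<close>

definition c1_compact :: "real \<Rightarrow> (real \<Rightarrow> real) \<Rightarrow> (real \<Rightarrow> real) \<Rightarrow> bool" where
  "c1_compact R \<phi> \<phi>' \<longleftrightarrow> 0 \<le> R \<and> (\<forall>t. (\<phi> has_real_derivative \<phi>' t) (at t)) \<and> continuous_on UNIV \<phi>' \<and>
     (\<forall>t. R \<le> \<bar>t\<bar> \<longrightarrow> \<phi> t = 0 \<and> \<phi>' t = 0)"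

lemma c1_compact_mono: "c1_compact R \<phi> \<phi>' \<Longrightarrow> R \<le> S \<Longrightarrow> c1_compact S \<phi> \<phi>'"
  unfolding c1_compact_def by auto

lemma c1_compact_cont: "c1_compact R \<phi> \<phi>' \<Longrightarrow> continuous_on A \<phi>"
  unfolding c1_compact_def by (meson DERIV_isCont continuous_at_imp_continuous_on)

lemma c1_compact_add:
  assumes "c1_compact R \<phi> \<phi>'" "c1_compact R \<psi> \<psi>'"
  shows "c1_compact R (\<lambda>t. \<phi> t + \<psi> t) (\<lambda>t. \<phi>' t + \<psi>' t)"
  using assms unfolding c1_compact_def by (auto intro!: derivative_intros continuous_intros)

lemma c1_compact_mult:
  assumes "c1_compact R \<phi> \<phi>'"
  shows "c1_compact R (\<lambda>t. a * \<phi> t) (\<lambda>t. a * \<phi>' t)"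
  using assms unfolding c1_compact_def by (auto intro!: derivative_eq_intros continuous_intros)

lemma integrable_compact_support:
  fixes \<phi> :: "real \<Rightarrow> real"
  assumes "continuous_on UNIV \<phi>" "\<And>t. R \<le> \<bar>t\<bar> \<Longrightarrow> \<phi> t = 0"
  shows "integrable lborel \<phi>"
proof -
  have "integrable lborel (\<lambda>t. indicator {-R..R} t *\<^sub>R \<phi> t)"
    by (rule borel_integrable_compact) (auto intro: continuous_on_subset[OF assms(1)])
  moreover have "(\<lambda>t. indicator {-R..R} t *\<^sub>R \<phi> t) = \<phi>"
  proof
    fix t show "indicator {-R..R} t *\<^sub>R \<phi> t = \<phi> t"
      using assms(2)[of t] by (cases "t \<in> {-R..R}") auto
  qed
  ultimately show ?thesis by simp
qed

lemma c1_compact_integrable: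
  assumes "c1_compact R \<phi> \<phi>'"
  shows "integrable lborel \<phi>" "integrable lborel (\<lambda>t. (\<phi> t)\<^sup>2)" "integrable lborel \<phi>'"
  by (rule integrable_compact_support[of _ R];
      use assms c1_compact_cont[OF assms] in \<open>auto simp: c1_compact_def intro!: continuous_intros\<close>)+

text \<open>This will evaluate the contribution of the step part of a test element.\<close>

lemma c1_compact_integral_tail:
  assumes \<phi>: "c1_compact R \<phi> \<phi>'"
  shows "(\<integral>t. \<phi>' t * indicator {a..} t \<partial>lborel) = - \<phi> a"
proof -
  let ?R = "max R a"
  have "(\<integral>t. \<phi>' t * indicator {a..} t \<partial>lborel) = (\<integral>t. \<phi>' t * indicator {a..?R} t \<partial>lborel)"
    using \<phi> by (intro Bochner_Integration.integral_cong) (auto simp: indicator_def c1_compact_def)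
  also have "\<dots> = \<phi> ?R - \<phi> a"
    using \<phi> by (intro integral_FTC_Icc_real) (auto simp: c1_compact_def continuous_on_eq_continuous_at)
  also have "\<phi> ?R = 0" using \<phi> by (simp add: c1_compact_def)
  finally show ?thesis by simp
qed

lemma c1_compact_integral_deriv:
  assumes \<phi>: "c1_compact R \<phi> \<phi>'"
  shows "(\<integral>t. \<phi>' t \<partial>lborel) = 0"
proof -
  have "(\<integral>t. \<phi>' t \<partial>lborel) = (\<integral>t. \<phi>' t * indicator {-R..} t \<partial>lborel)"
    using \<phi> by (intro Bochner_Integration.integral_cong) (auto simp: indicator_def c1_compact_def)
  also have "\<dots> = 0" using \<phi> unfolding c1_compact_integral_tail[OF \<phi>] by (simp add: c1_compact_def)
  finally show ?thesis .
qed

text \<open>The constant value reached beyond the support is what the jump will later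
  cancel.\<close>

lemma c1_compact_antiderivative:
  assumes \<phi>: "c1_compact R \<phi> \<phi>'"
  obtains F where "\<And>t. (F has_real_derivative \<phi> t) (at t)" "\<And>t. t \<le> -R \<Longrightarrow> F t = 0"
    "\<And>t. R \<le> t \<Longrightarrow> F t = integral\<^sup>L lborel \<phi>"
proof -
  have R: "0 \<le> R" using \<phi> by (simp add: c1_compact_def)
  have cont: "isCont \<phi> t" for t using \<phi> by (auto simp: c1_compact_def intro: DERIV_isCont)
  obtain F0 where F0: "\<And>t. (F0 has_real_derivative \<phi> t) (at t)"
    using einterval_antiderivative[of "-\<infinity>" \<infinity> \<phi>] cont by (auto simp: has_real_derivative_iff_has_vector_derivative)
  define F where "F t = F0 t - F0 (-R)" for t
  have F: "(F has_real_derivative \<phi> t) (at t)" for t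
    unfolding F_def using F0 by (auto intro!: derivative_eq_intros)
  have const: "F a = F b" if "a \<le> b" "b \<le> -R \<or> R \<le> a" for a b
  proof (cases "a = b")
    case False
    then have "a < b" using that by simp
    from MVT2[OF this, of F \<phi>] F obtain z where z: "a < z" "z < b" "F b - F a = (b - a) * \<phi> z" by blast
    have "\<phi> z = 0" using z that \<phi> unfolding c1_compact_def by auto
    then show ?thesis using z by simp
  qed simp
  have "\<phi> t = \<phi> t * indicator {-R..R} t" for t
    using \<phi> by (cases "t \<in> {-R..R}") (auto simp: c1_compact_def)
  then have "integral\<^sup>L lborel \<phi> = (\<integral>t. \<phi> t * indicator {-R..R} t \<partial>lborel)"
    by (intro Bochner_Integration.integral_cong) auto
  also have "\<dots> = F R - F (-R)"
    using F cont R by (intro integral_FTC_Icc_real) auto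
  finally have FR: "F R = integral\<^sup>L lborel \<phi>" by (simp add: F_def)
  show ?thesis
  proof (rule that[of F, OF F])
    show "F t = 0" if "t \<le> -R" for t using const[of t "-R"] that by (simp add: F_def)
    show "F t = integral\<^sup>L lborel \<phi>" if "R \<le> t" for t using const[of R t] that FR by simp
  qed
qed

text \<open>Squaring the positive part of a parabola gives a C^1 function. That regularity suffices:
  these functions build f', and f'' only has to be square integrable.\<close>

definition bump :: "real \<Rightarrow> real \<Rightarrow> real \<Rightarrow> real" where
  "bump s w t = (max 0 (w\<^sup>2 - (t - s)\<^sup>2))\<^sup>2"

lemma bump_nonneg: "0 \<le> bump s w t"
  by (simp add: bump_def)

lemma bump_eq_0: "0 \<le> w \<Longrightarrow> w \<le> \<bar>t - s\<bar> \<Longrightarrow> bump s w t = 0"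
  using abs_le_square_iff[of w "t - s"] by (simp add: bump_def)

lemma bump_center: "0 \<le> w \<Longrightarrow> bump s w s = w ^ 4"
  by (simp add: bump_def flip: power_mult)

lemma bump_le: "bump s w t \<le> w ^ 4"
proof -
  have "(max 0 (w\<^sup>2 - (t - s)\<^sup>2))\<^sup>2 \<le> (w\<^sup>2)\<^sup>2" by (rule power_mono) auto
  then show ?thesis by (simp add: bump_def flip: power_mult)
qed

lemma has_real_derivative_pos_part_square:
  "((\<lambda>u::real. (max 0 u)\<^sup>2) has_real_derivative 2 * max 0 u) (at u)"
proof -
  consider "u < 0" | "u = 0" | "u > 0" by linarith
  then show ?thesis
  proof cases
    case 1
    have "((\<lambda>u::real. 0) has_real_derivative 0) (at u)" by simp
    then show ?thesis
      by (rule has_field_derivative_transform_within_open[of _ _ _ "{..<0}", THEN DERIV_cong]) (use 1 in auto)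
  next
    case 2
    have "((\<lambda>v::real. (max 0 v)\<^sup>2 / v) \<longlongrightarrow> 0) (at 0)"
    proof (rule Lim_null_comparison)
      show "((\<lambda>v::real. \<bar>v\<bar>) \<longlongrightarrow> 0) (at 0)" by (auto intro!: tendsto_eq_intros)
      show "\<forall>\<^sub>F v in at (0::real). norm ((max 0 v)\<^sup>2 / v) \<le> \<bar>v\<bar>"
        by (rule always_eventually) (auto simp: max_def power2_eq_square)
    qed
    then show ?thesis using 2 by (simp add: has_field_derivative_iff)
  next
    case 3
    have "((\<lambda>u::real. u\<^sup>2) has_real_derivative 2 * u) (at u)" by (auto intro!: derivative_eq_intros)
    then show ?thesis
      by (rule has_field_derivative_transform_within_open[of _ _ _ "{0<..}", THEN DERIV_cong]) (use 3 in auto)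
  qed
qed

lemma c1_compact_bump:
  assumes w: "0 < w" and R: "\<bar>s\<bar> + w \<le> R"
  shows "c1_compact R (bump s w) (\<lambda>t. 2 * max 0 (w\<^sup>2 - (t - s)\<^sup>2) * (- 2 * (t - s)))"
  unfolding c1_compact_def
proof (intro conjI allI impI)
  fix t
  have "((\<lambda>t. w\<^sup>2 - (t - s)\<^sup>2) has_real_derivative - 2 * (t - s)) (at t)"
    by (auto intro!: derivative_eq_intros)
  from DERIV_chain2[OF has_real_derivative_pos_part_square this]
  show "(bump s w has_real_derivative 2 * max 0 (w\<^sup>2 - (t - s)\<^sup>2) * (- 2 * (t - s))) (at t)"
    unfolding bump_def .
next
  fix t assume "R \<le> \<bar>t\<bar>"
  then have ts: "w \<le> \<bar>t - s\<bar>" using R by linarith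
  then show "bump s w t = 0" using w by (simp add: bump_eq_0)
  have "w\<^sup>2 \<le> (t - s)\<^sup>2" using ts w abs_le_square_iff[of w "t - s"] by simp
  then show "2 * max 0 (w\<^sup>2 - (t - s)\<^sup>2) * (- 2 * (t - s)) = 0" by simp
qed (use w R in \<open>auto intro!: continuous_intros\<close>)

lemma integral_bump_translate:
  "(\<integral>t. (bump s w t) ^ n \<partial>lborel) = (\<integral>t. (bump 0 w t) ^ n \<partial>lborel)"
  by (subst lborel_integral_real_affine[of 1 _ s]) (simp_all add: bump_def)

lemma integral_bump_pos:
  assumes w: "0 < w" shows "0 < (\<integral>t. bump 0 w t \<partial>lborel)"
proof -
  have c: "c1_compact w (bump 0 w) (\<lambda>t. 2 * max 0 (w\<^sup>2 - (t - 0)\<^sup>2) * (- 2 * (t - 0)))"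
    by (rule c1_compact_bump) (use w in auto)
  \<comment> \<open>A lower bound of the bump on the middle half of its support.\<close>
  let ?m = "((3 / 4) * w\<^sup>2)\<^sup>2"
  have "0 < w * ?m" using w by simp
  also have "w * ?m = (\<integral>t. indicator {-w/2..w/2} t *\<^sub>R ?m \<partial>lborel)" using w by simp
  also have "\<dots> \<le> (\<integral>t. bump 0 w t \<partial>lborel)"
  proof (rule integral_mono[OF _ c1_compact_integrable(1)[OF c]])
    show "integrable lborel (\<lambda>t. indicator {-w/2..w/2} t *\<^sub>R ?m)"
      using w by (intro integrable_scaleR_left integrable_real_indicator) auto
    fix t
    show "indicator {-w/2..w/2} t *\<^sub>R ?m \<le> bump 0 w t"
    proof (cases "t \<in> {-w/2..w/2}")
      case True
      then have "t\<^sup>2 \<le> (w/2)\<^sup>2" by (auto simp: abs_le_square_iff[symmetric])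
      then have "(3 / 4) * w\<^sup>2 \<le> w\<^sup>2 - t\<^sup>2" by (simp add: power_divide)
      then have "(3 / 4) * w\<^sup>2 \<le> max 0 (w\<^sup>2 - t\<^sup>2)" by (rule max.coboundedI2)
      then have "?m \<le> (max 0 (w\<^sup>2 - t\<^sup>2))\<^sup>2" by (intro power_mono) auto
      then show ?thesis using True by (simp add: bump_def)
    qed (simp add: bump_nonneg)
  qed
  finally show ?thesis .
qed

context point_sequence
begin

text \<open>The low wave: one bump in the first stretch of length \<open>d\<close> of each of
  \<open>M\<close> successive gaps. It vanishes at every point of the sequence, and since the bumps
  do not overlap, its integral and its squared norm both grow linearly in \<open>M\<close>.\<close>

definition spread :: "nat \<Rightarrow> real \<Rightarrow> real" where
  "spread M t = (\<Sum>i<M. bump (x (int i) + d / 2) (d / 2) t)"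

lemma bump_spread_0:
  assumes "t \<le> x i \<or> x (i + 1) \<le> t"
  shows "bump (x i + d / 2) (d / 2) t = 0"
  using assms d gap[of i] by (intro bump_eq_0) auto

lemma spread_at: "spread M (x j) = 0"
  unfolding spread_def
proof (intro sum.neutral ballI bump_spread_0)
  fix i assume "i \<in> {..<M}"
  show "x j \<le> x (int i) \<or> x (int i + 1) \<le> x j"
    using mono by (auto simp: strict_mono_less_eq)
qed

lemma c1_compact_spread: "\<exists>R D. c1_compact R (spread M) D"
proof (induction M)
  case 0
  have "spread 0 = (\<lambda>_. 0)" by (simp add: spread_def fun_eq_iff)
  then have "c1_compact 0 (spread 0) (\<lambda>_. 0)" by (simp add: c1_compact_def)
  then show ?case by blast
next
  case (Suc M)
  then obtain R D where R: "c1_compact R (spread M) D" by blast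
  obtain D' where D': "c1_compact (\<bar>x (int M) + d / 2\<bar> + d / 2) (bump (x (int M) + d / 2) (d / 2)) D'"
    using c1_compact_bump[OF _ order.refl] d by (metis half_gt_zero)
  have "c1_compact (max R (\<bar>x (int M) + d / 2\<bar> + d / 2)) (\<lambda>t. spread M t + bump (x (int M) + d / 2) (d / 2) t) (\<lambda>t. D t + D' t)"
    by (intro c1_compact_add c1_compact_mono[OF R] c1_compact_mono[OF D']) auto
  then show ?case by (auto simp: spread_def)
qed

lemma integral_bump_gap:
  "integrable lborel (\<lambda>t. bump (x i + d / 2) (d / 2) t)"
  "integrable lborel (\<lambda>t. (bump (x i + d / 2) (d / 2) t)\<^sup>2)"
  using c1_compact_integrable[OF c1_compact_bump[OF _ order.refl, of "d/2" "x i + d / 2"]] d by auto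

lemma integral_spread: "(\<integral>t. spread M t \<partial>lborel) = real M * (\<integral>t. bump 0 (d / 2) t \<partial>lborel)"
proof -
  have "(\<integral>t. spread M t \<partial>lborel) = (\<Sum>i<M. \<integral>t. bump (x (int i) + d / 2) (d / 2) t \<partial>lborel)"
    unfolding spread_def by (simp add: integral_bump_gap)
  also have "\<dots> = (\<Sum>i<M. \<integral>t. bump 0 (d / 2) t \<partial>lborel)"
    using integral_bump_translate[of _ "d / 2" 1] by (intro sum.cong refl) (simp only: power_one_right)
  finally show ?thesis by simp
qed

lemma integral_spread_square:
  "(\<integral>t. (spread M t)\<^sup>2 \<partial>lborel) = real M * (\<integral>t. (bump 0 (d / 2) t)\<^sup>2 \<partial>lborel)"
proof -
  have "(spread M t)\<^sup>2 = (\<Sum>i<M. (bump (x (int i) + d / 2) (d / 2) t)\<^sup>2)" for t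
  proof -
    have "bump (x (int i) + d / 2) (d / 2) t * bump (x (int j) + d / 2) (d / 2) t = 0" if "i < j" for i j
    proof -
      have "x (int i + 1) \<le> x (int j)" using mono that by (auto simp: strict_mono_less_eq)
      then have "x (int i + 1) \<le> t \<or> t \<le> x (int j)" by linarith
      then show ?thesis using bump_spread_0[of t "int i"] bump_spread_0[of t "int j"] by auto
    qed
    then have off: "bump (x (int i) + d / 2) (d / 2) t * bump (x (int j) + d / 2) (d / 2) t = 0" if "i \<noteq> j" for i j
      using that by (metis linorder_neqE_nat mult.commute)
    have "(spread M t)\<^sup>2 = (\<Sum>i<M. \<Sum>j<M. bump (x (int i) + d / 2) (d / 2) t * bump (x (int j) + d / 2) (d / 2) t)"
      by (simp add: spread_def power2_eq_square sum_product)
    also have "\<dots> = (\<Sum>i<M. \<Sum>j<M. if j = i then (bump (x (int i) + d / 2) (d / 2) t)\<^sup>2 else 0)"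
      using off by (intro sum.cong refl) (auto simp: power2_eq_square)
    finally show ?thesis by simp
  qed
  then have "(\<integral>t. (spread M t)\<^sup>2 \<partial>lborel) = (\<Sum>i<M. \<integral>t. (bump (x (int i) + d / 2) (d / 2) t)\<^sup>2 \<partial>lborel)"
    by (simp add: integral_bump_gap)
  also have "\<dots> = (\<Sum>i<M. \<integral>t. (bump 0 (d / 2) t)\<^sup>2 \<partial>lborel)"
    by (intro sum.cong refl integral_bump_translate)
  finally show ?thesis by simp
qed

text \<open>The peak \<open>p\<close> carries the point values and has a small norm when it is
  narrow. The missing mass \<open>q\<close> is supplied by a multiple of \<open>spread M\<close>, at
  a cost q^2 C / (A^2 M) in squared norm, which tends to 0 as \<open>M\<close> grows.\<close>

lemma test_function_exists:
  fixes b \<epsilon> :: real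
  assumes \<epsilon>: "0 < \<epsilon>"
  obtains R \<phi> \<phi>' where "c1_compact R \<phi> \<phi>'" "\<And>j. \<phi> (x j) = (if j = k then 1 else 0)"
    "integral\<^sup>L lborel \<phi> = b" "(\<integral>t. (\<phi> t)\<^sup>2 \<partial>lborel) \<le> \<epsilon>"
proof -
  \<comment> \<open>w \<le> d makes the peak vanish at all other points; w \<le> \<epsilon> / 8
    makes twice its squared norm at most 4 w \<le> \<epsilon> / 2.\<close>
  define w where "w = min d (\<epsilon> / 8)"
  have w: "0 < w" "w \<le> d" "w \<le> \<epsilon> / 8" using d \<epsilon> by (auto simp: w_def)
  define p where "p t = (1 / w ^ 4) * bump (x k) w t" for t
  obtain R1 p' where p: "c1_compact R1 p p'"
    unfolding p_def using c1_compact_mult[OF c1_compact_bump[OF w(1) order.refl]] by blast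
  have p_at: "p (x j) = (if j = k then 1 else 0)" for j
  proof (cases "j = k")
    case True then show ?thesis using w by (simp add: p_def bump_center)
  next
    case False
    then have "j \<le> k - 1 \<or> k + 1 \<le> j" by linarith
    then have "x j \<le> x (k - 1) \<or> x (k + 1) \<le> x j" using mono by (auto simp: strict_mono_less_eq)
    then have "w \<le> \<bar>x j - x k\<bar>" using gap[of k] gap[of "k - 1"] w by auto
    then show ?thesis using False w by (simp add: p_def bump_eq_0)
  qed
  have p01: "0 \<le> p t" "p t \<le> 1" for t
    using bump_le[of "x k" w t] w by (auto simp: p_def bump_nonneg field_simps)
  have "(\<integral>t. (p t)\<^sup>2 \<partial>lborel) \<le> (\<integral>t. indicator {x k - w..x k + w} t \<partial>lborel)"
  proof (rule integral_mono[OF c1_compact_integrable(2)[OF p]])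
    show "(p t)\<^sup>2 \<le> indicator {x k - w..x k + w} t" for t
    proof (cases "t \<in> {x k - w..x k + w}")
      case True then show ?thesis using p01[of t] by (simp add: power_le_one)
    next
      case False then show ?thesis using w by (auto simp: p_def bump_eq_0)
    qed
  qed (use w in simp)
  then have p2: "(\<integral>t. (p t)\<^sup>2 \<partial>lborel) \<le> 2 * w" using w by simp
  define A where "A = (\<integral>t. bump 0 (d / 2) t \<partial>lborel)"
  define C where "C = (\<integral>t. (bump 0 (d / 2) t)\<^sup>2 \<partial>lborel)"
  define q where "q = b - integral\<^sup>L lborel p"
  have A: "0 < A" unfolding A_def by (rule integral_bump_pos) (use d in simp)
  have C: "0 \<le> C" unfolding C_def by (rule integral_nonneg_AE) simp
  \<comment> \<open>Chosen so that twice the cost of the wave is at most \<epsilon> / 2; the 1 keeps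
    \<open>M\<close> positive for the division in \<open>\<gamma>\<close>.\<close>
  obtain M :: nat where M: "max 1 (4 * q\<^sup>2 * C / (A\<^sup>2 * \<epsilon>)) \<le> real M" using real_arch_simple by blast
  define \<gamma> where "\<gamma> = q / (real M * A)"
  obtain R2 s' where s: "c1_compact R2 (spread M) s'" using c1_compact_spread by blast
  define \<phi> where "\<phi> t = p t + \<gamma> * spread M t" for t
  have c: "c1_compact (max R1 R2) \<phi> (\<lambda>t. p' t + \<gamma> * s' t)"
    unfolding \<phi>_def by (intro c1_compact_add c1_compact_mult c1_compact_mono[OF p] c1_compact_mono[OF s]) auto
  show ?thesis
  proof (rule that[OF c])
    show "\<phi> (x j) = (if j = k then 1 else 0)" for j by (simp add: \<phi>_def p_at spread_at)
    have "integral\<^sup>L lborel \<phi> = integral\<^sup>L lborel p + \<gamma> * (real M * A)"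
      unfolding \<phi>_def A_def integral_spread[symmetric]
      using c1_compact_integrable(1)[OF p] c1_compact_integrable(1)[OF s] by simp
    then show "integral\<^sup>L lborel \<phi> = b" using M A by (simp add: \<gamma>_def q_def)
    have "(\<integral>t. (\<phi> t)\<^sup>2 \<partial>lborel) \<le> (\<integral>t. 2 * (p t)\<^sup>2 + 2 * \<gamma>\<^sup>2 * (spread M t)\<^sup>2 \<partial>lborel)"
    proof (rule integral_mono[OF c1_compact_integrable(2)[OF c]])
      show "(\<phi> t)\<^sup>2 \<le> 2 * (p t)\<^sup>2 + 2 * \<gamma>\<^sup>2 * (spread M t)\<^sup>2" for t
        using sum_squares_bound[of "p t" "\<gamma> * spread M t"] by (simp add: \<phi>_def power2_sum power_mult_distrib)
    qed (use c1_compact_integrable(2)[OF p] c1_compact_integrable(2)[OF s] in simp)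
    also have "\<dots> = 2 * (\<integral>t. (p t)\<^sup>2 \<partial>lborel) + 2 * \<gamma>\<^sup>2 * (real M * C)"
      unfolding C_def integral_spread_square[symmetric]
      using c1_compact_integrable(2)[OF p] c1_compact_integrable(2)[OF s] by simp
    also have "2 * \<gamma>\<^sup>2 * (real M * C) = 2 * q\<^sup>2 * C / (A\<^sup>2 * real M)"
      using M A by (simp add: \<gamma>_def field_simps power2_eq_square)
    also have "\<dots> \<le> \<epsilon> / 2"
      using M A \<epsilon> by (simp add: field_simps)
    finally show "(\<integral>t. (\<phi> t)\<^sup>2 \<partial>lborel) \<le> \<epsilon>" using p2 w by linarith
  qed
qed

end

section \<open>Upper bound: linearity of the domain and embedding by boundary values\<close>

lemma abs_L2_diff_scale:
  assumes "sq_integrable f" "sq_integrable g"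
  shows "abs_L2 f - scaleC_L2 a (abs_L2 g) = abs_L2 (\<lambda>t. f t + - a * g t)"
proof -
  have "abs_L2 f - scaleC_L2 a (abs_L2 g) = abs_L2 f + scaleC_L2 (- a) (abs_L2 g)" by simp
  also have "\<dots> = abs_L2 (\<lambda>t. f t + - a * g t)"
    unfolding abs_L2_scale[OF assms(2)] using assms by (intro abs_L2_add sq_integrable_mult)
  finally show ?thesis .
qed

lemma AC_loc_lincomb: "AC_loc S F \<Longrightarrow> AC_loc S G \<Longrightarrow> AC_loc S (\<lambda>t. F t + s * G t)"
  unfolding AC_loc_def by (blast intro: abs_continuous_lincomb)

lemma W22_lincomb:
  assumes f: "W22 X f f1 f2" and g: "W22 X g g1 g2"
  shows "W22 X (\<lambda>t. f t + s * g t) (\<lambda>t. f1 t + s * g1 t) (\<lambda>t. f2 t + s * g2 t)"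
proof -
  have "AE t in lborel. t \<in> - X \<longrightarrow> (f1 has_vector_derivative f2 t) (at t)"
    "AE t in lborel. t \<in> - X \<longrightarrow> (g1 has_vector_derivative g2 t) (at t)"
    using f g by (auto simp: W22_def)
  then have "AE t in lborel. t \<in> - X \<longrightarrow> ((\<lambda>t. f1 t + s * g1 t) has_vector_derivative f2 t + s * g2 t) (at t)"
    by eventually_elim (auto intro!: derivative_intros)
  then show ?thesis
    using f g unfolding W22_def
    by (auto intro!: sq_integrable_add sq_integrable_mult AC_loc_lincomb derivative_intros)
qed

context point_sequence
begin

lemma negative_squares_le_card:
  assumes E: "is_spectral_measure_of E (delta'_operator x \<beta>)" and fin: "finite {k. \<beta> k < 0}"
  shows "negative_squares E \<le> enat (card {k. \<beta> k < 0})"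
proof -
  define bc where "bc f f1 c \<longleftrightarrow> (\<forall>k. \<exists>l r.
           (f1 \<longlongrightarrow> c k) (at_left (x k)) \<and> (f1 \<longlongrightarrow> c k) (at_right (x k)) \<and>
           (f \<longlongrightarrow> l) (at_left (x k)) \<and> (f \<longlongrightarrow> r) (at_right (x k)) \<and>
           r - l = complex_of_real (\<beta> k) * c k)" for f f1 :: "real \<Rightarrow> complex" and c
  \<comment> \<open>The graph of the operator enriched by the family \<open>c\<close> of derivatives
    at the points. The values on negative indices are the functionals to be counted.\<close>
  define G where "G = {(abs_L2 f, abs_L2 (\<lambda>t. - f2 t), c) | f f1 f2 c. W22 (range x) f f1 f2 \<and> bc f f1 c}"
  show ?thesis
  proof (rule negative_squares_le[OF E fin, of G])
    fix f u assume "(f, u) \<in> delta'_operator x \<beta>"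
    then obtain F f1 f2 where F: "f = abs_L2 F" "W22 (range x) F f1 f2"
        "\<forall>k. \<exists>c l r. (f1 \<longlongrightarrow> c) (at_left (x k)) \<and> (f1 \<longlongrightarrow> c) (at_right (x k)) \<and>
           (F \<longlongrightarrow> l) (at_left (x k)) \<and> (F \<longlongrightarrow> r) (at_right (x k)) \<and>
           r - l = complex_of_real (\<beta> k) * c"
      unfolding delta'_operator_def by blast
    from choice[OF F(3)] obtain c where "bc F f1 c" unfolding bc_def by blast
    then show "\<exists>v c. (f, v, c) \<in> G" using F unfolding G_def by blast
  next
    fix f u c g v d a assume "(f, u, c) \<in> G" "(g, v, d) \<in> G"
    then obtain F f1 f2 H h1 h2 where
      F: "f = abs_L2 F" "u = abs_L2 (\<lambda>t. - f2 t)" "W22 (range x) F f1 f2" "bc F f1 c" and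
      H: "g = abs_L2 H" "v = abs_L2 (\<lambda>t. - h2 t)" "W22 (range x) H h1 h2" "bc H h1 d"
      unfolding G_def by blast
    have sq: "sq_integrable F" "sq_integrable H" "sq_integrable f2" "sq_integrable h2"
      using F H by (auto simp: W22_def)
    have f: "f - scaleC_L2 a g = abs_L2 (\<lambda>t. F t + - a * H t)"
      unfolding F(1) H(1) by (rule abs_L2_diff_scale) (fact sq)+
    have "u - scaleC_L2 a v = abs_L2 (\<lambda>t. - f2 t + - a * - h2 t)"
      unfolding F(2) H(2) by (rule abs_L2_diff_scale) (intro sq_integrable_uminus sq)+
    then have u: "u - scaleC_L2 a v = abs_L2 (\<lambda>t. - (f2 t + - a * h2 t))" by simp
    have bc: "bc (\<lambda>t. F t + - a * H t) (\<lambda>t. f1 t + - a * h1 t) (\<lambda>i. c i - a * d i)"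
      unfolding bc_def
    proof
      fix k
      obtain l r where lr: "(f1 \<longlongrightarrow> c k) (at_left (x k))" "(f1 \<longlongrightarrow> c k) (at_right (x k))"
           "(F \<longlongrightarrow> l) (at_left (x k))" "(F \<longlongrightarrow> r) (at_right (x k))"
           "r - l = complex_of_real (\<beta> k) * c k" using F(4) unfolding bc_def by blast
      obtain l' r' where lr': "(h1 \<longlongrightarrow> d k) (at_left (x k))" "(h1 \<longlongrightarrow> d k) (at_right (x k))"
           "(H \<longlongrightarrow> l') (at_left (x k))" "(H \<longlongrightarrow> r') (at_right (x k))"
           "r' - l' = complex_of_real (\<beta> k) * d k" using H(4) unfolding bc_def by blast
      have "(r + - a * r') - (l + - a * l') = (r - l) - a * (r' - l')" by (simp add: algebra_simps)
      also have "\<dots> = complex_of_real (\<beta> k) * (c k - a * d k)"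
        unfolding lr(5) lr'(5) by (simp add: algebra_simps)
      finally show "\<exists>l r. ((\<lambda>t. f1 t + - a * h1 t) \<longlongrightarrow> c k - a * d k) (at_left (x k)) \<and>
         ((\<lambda>t. f1 t + - a * h1 t) \<longlongrightarrow> c k - a * d k) (at_right (x k)) \<and>
         ((\<lambda>t. F t + - a * H t) \<longlongrightarrow> l) (at_left (x k)) \<and>
         ((\<lambda>t. F t + - a * H t) \<longlongrightarrow> r) (at_right (x k)) \<and>
         r - l = complex_of_real (\<beta> k) * (c k - a * d k)"
        using lr(1-4) lr'(1-4)
        by (intro exI[of _ "l + - a * l'"] exI[of _ "r + - a * r'"] conjI) (auto intro!: tendsto_eq_intros)
    qed
    show "(f - scaleC_L2 a g, u - scaleC_L2 a v, \<lambda>i. c i - a * d i) \<in> G"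
      unfolding f u G_def by (intro CollectI exI conjI, rule refl, rule W22_lincomb[OF F(3) H(3)], rule bc)
  next
    fix f u c assume "(f, u, c) \<in> G" and c0: "\<forall>k\<in>{k. \<beta> k < 0}. c k = 0"
    then obtain F f1 f2 where
      F: "f = abs_L2 F" "u = abs_L2 (\<lambda>t. - f2 t)" "W22 (range x) F f1 f2" and bc: "bc F f1 c"
      unfolding G_def by blast
    have T: "(f, u) \<in> delta'_operator x \<beta>"
      using F bc unfolding delta'_operator_def bc_def by blast
    from choice[OF bc[unfolded bc_def]] obtain l where
      "\<forall>k. \<exists>r. (f1 \<longlongrightarrow> c k) (at_left (x k)) \<and> (f1 \<longlongrightarrow> c k) (at_right (x k)) \<and>
           (F \<longlongrightarrow> l k) (at_left (x k)) \<and> (F \<longlongrightarrow> r) (at_right (x k)) \<and>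
           r - l k = complex_of_real (\<beta> k) * c k" by blast
    from choice[OF this] obtain r where
      lr: "\<forall>k. (f1 \<longlongrightarrow> c k) (at_left (x k)) \<and> (f1 \<longlongrightarrow> c k) (at_right (x k)) \<and>
           (F \<longlongrightarrow> l k) (at_left (x k)) \<and> (F \<longlongrightarrow> r k) (at_right (x k)) \<and>
           r k - l k = complex_of_real (\<beta> k) * c k" by blast
    interpret delta'_element x d \<beta> F f1 f2 c l r
      by unfold_locales (use F lr c0 in \<open>auto simp: not_less\<close>)
    have sq: "sq_integrable F" "sq_integrable (\<lambda>t. - f2 t)"
      using F(3) by (auto simp: W22_def intro: sq_integrable_uminus)
    have "Re (cinner_L2 u f) = (\<integral>t. Re (- f2 t * cnj (F t)) \<partial>lborel)"
      unfolding F cinner_abs_L2[OF sq(2) sq(1)]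
      by (rule integral_Re[symmetric]) (rule sq_integrable_imp_integrable_mult_cnj[OF sq(2) sq(1)])
    also have "\<dots> = - integral\<^sup>L lborel h"
      unfolding Bochner_Integration.integral_minus[symmetric]
      by (intro Bochner_Integration.integral_cong) (auto simp: h_def)
    finally show "(f, u) \<in> delta'_operator x \<beta> \<and> 0 \<le> Re (cinner_L2 u f)"
      using T integral_h_nonpos by simp
  qed
qed

end

section \<open>Lower bound: domain elements built from the test functions\<close>

lemma sq_integrable_compact_support:
  fixes f :: "real \<Rightarrow> real"
  assumes "f \<in> borel_measurable borel" "\<And>t. R < \<bar>t\<bar> \<Longrightarrow> f t = 0" "\<And>t. \<bar>t\<bar> \<le> R \<Longrightarrow> \<bar>f t\<bar> \<le> B"
  shows "sq_integrable (\<lambda>t. complex_of_real (f t))"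
proof -
  have "integrable lborel (\<lambda>t. indicator {-R..R} t *\<^sub>R B\<^sup>2)"
    by (cases "0 \<le> R") (auto intro!: integrable_scaleR_left integrable_real_indicator)
  then have "integrable lborel (\<lambda>t. (f t)\<^sup>2)"
  proof (rule Bochner_Integration.integrable_bound)
    show "AE t in lborel. norm ((f t)\<^sup>2) \<le> norm (indicator {-R..R} t *\<^sub>R B\<^sup>2)"
    proof (rule AE_I2)
      fix t show "norm ((f t)\<^sup>2) \<le> norm (indicator {-R..R} t *\<^sub>R B\<^sup>2)"
      proof (cases "\<bar>t\<bar> \<le> R")
        case True
        then have "(f t)\<^sup>2 \<le> B\<^sup>2" using power_mono[OF assms(3)[OF True], of 2] by simp
        then show ?thesis using True by (simp add: indicator_def abs_le_iff)
      next
        case False then show ?thesis using assms(2)[of t] by simp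
      qed
    qed
  qed (use assms(1) in measurable)
  then show ?thesis using assms(1) by (simp add: sq_integrable_def)
qed

lemma of_real_deriv:
  "(f has_real_derivative D) (at t) \<Longrightarrow> ((\<lambda>t. complex_of_real (f t)) has_vector_derivative complex_of_real D) (at t)"
  by (rule has_vector_derivative_of_real)

definition step_test :: "(real \<Rightarrow> real) \<Rightarrow> real \<Rightarrow> real \<Rightarrow> real \<Rightarrow> real" where
  "step_test F b a t = F t + b * indicator {a..} t"

text \<open>Here \<phi> plays f' and \<open>\<phi>'\<close> plays f''. The antiderivative
  \<open>F\<close> ends at -b, so adding a step of height \<open>b\<close> at \<open>x k\<close>
  gives a compactly supported function.\<close>

locale step_element = point_sequence +
  fixes k :: int and b R :: real and \<phi> \<phi>' F :: "real \<Rightarrow> real"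
  assumes c1: "c1_compact R \<phi> \<phi>'" and \<phi>_at: "\<And>j. \<phi> (x j) = (if j = k then 1 else 0)"
    and F: "\<And>t. (F has_real_derivative \<phi> t) (at t)" "\<And>t. t \<le> -R \<Longrightarrow> F t = 0" "\<And>t. R \<le> t \<Longrightarrow> F t = - b"
begin

lemma F_cont: "continuous_on A F"
  using F(1) by (meson DERIV_isCont continuous_at_imp_continuous_on)

lemma step_sq_integrable: "sq_integrable (\<lambda>t. complex_of_real (step_test F b (x k) t))"
proof -
  let ?R = "max R \<bar>x k\<bar>"
  have "bounded (F ` {- ?R..?R})" by (intro compact_imp_bounded compact_continuous_image F_cont) auto
  then obtain B where B: "\<And>t. t \<in> {- ?R..?R} \<Longrightarrow> \<bar>F t\<bar> \<le> B" unfolding bounded_iff by (metis imageI real_norm_def)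
  have [measurable]: "F \<in> borel_measurable borel" by (rule borel_measurable_continuous_onI) (rule F_cont)
  show ?thesis
  proof (rule sq_integrable_compact_support[of _ ?R "B + \<bar>b\<bar>"])
    show "step_test F b (x k) \<in> borel_measurable borel" unfolding step_test_def by measurable
    show "step_test F b (x k) t = 0" if t: "?R < \<bar>t\<bar>" for t
    proof (cases "t \<ge> 0")
      case True
      then have "R \<le> t" "x k \<le> t" using t by auto
      then show ?thesis using F(3)[of t] by (simp add: step_test_def)
    next
      case False
      then have "t \<le> - R" "t < x k" using t by auto
      then show ?thesis using F(2)[of t] by (simp add: step_test_def)
    qed
    show "\<bar>step_test F b (x k) t\<bar> \<le> B + \<bar>b\<bar>" if "\<bar>t\<bar> \<le> ?R" for t
    proof -
      have "\<bar>F t\<bar> \<le> B" using that by (intro B) auto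
      moreover have "\<bar>b * indicator {x k..} t\<bar> \<le> \<bar>b\<bar>" by (simp add: indicator_def)
      ultimately show ?thesis unfolding step_test_def by linarith
    qed
  qed
qed

lemma deriv_sq_integrable: "sq_integrable (\<lambda>t. complex_of_real (\<phi>' t))"
proof -
  have cont: "continuous_on A \<phi>'" for A using c1 by (auto simp: c1_compact_def intro: continuous_on_subset)
  have "bounded (\<phi>' ` {- R..R})" by (intro compact_imp_bounded compact_continuous_image cont) auto
  then obtain B where B: "\<And>t. t \<in> {- R..R} \<Longrightarrow> \<bar>\<phi>' t\<bar> \<le> B" unfolding bounded_iff by (metis imageI real_norm_def)
  show ?thesis
    by (rule sq_integrable_compact_support[of _ R B])
      (use c1 B in \<open>auto simp: c1_compact_def abs_le_iff intro!: borel_measurable_continuous_onI\<close>)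
qed

lemma step_deriv:
  assumes "t \<noteq> x k"
  shows "(step_test F b (x k) has_real_derivative \<phi> t) (at t)"
proof (cases "t < x k")
  case True
  show ?thesis
    by (rule has_field_derivative_transform_within_open[OF F(1), of "{..<x k}"]) (use True in \<open>auto simp: step_test_def\<close>)
next
  case False
  have "((\<lambda>t. F t + b) has_real_derivative \<phi> t) (at t)" using F(1) by (auto intro!: derivative_eq_intros)
  then show ?thesis
    by (rule has_field_derivative_transform_within_open[of _ _ _ "{x k<..}"]) (use False assms in \<open>auto simp: step_test_def\<close>)
qed

lemma step_W22:
  "W22 (range x) (\<lambda>t. complex_of_real (step_test F b (x k) t)) (\<lambda>t. complex_of_real (\<phi> t)) (\<lambda>t. complex_of_real (\<phi>' t))"
  unfolding W22_def AC_loc_def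
proof (intro conjI allI impI ballI AE_I2)
  show f': "((\<lambda>t. complex_of_real (step_test F b (x k) t)) has_vector_derivative complex_of_real (\<phi> t)) (at t)"
    if "t \<in> - range x" for t
    using that by (intro of_real_deriv step_deriv) auto
  show f'': "((\<lambda>t. complex_of_real (\<phi> t)) has_vector_derivative complex_of_real (\<phi>' t)) (at t)" for t
    using c1 by (intro of_real_deriv) (auto simp: c1_compact_def)
  fix a c
  show "abs_continuous_on_interval a c (\<lambda>t. complex_of_real (\<phi> t))"
    using c1 f'' by (intro abs_continuous_C1[of _ _ _ "\<lambda>t. complex_of_real (\<phi>' t)"])
      (auto simp: c1_compact_def intro!: continuous_intros elim: continuous_on_subset)
  assume "{a..c} \<subseteq> - range x"
  then show "abs_continuous_on_interval a c (\<lambda>t. complex_of_real (step_test F b (x k) t))"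
    using f' c1_compact_cont[OF c1]
    by (intro abs_continuous_C1[of _ _ _ "\<lambda>t. complex_of_real (\<phi> t)"]) (auto intro!: continuous_intros)
qed (rule step_sq_integrable deriv_sq_integrable)+

text \<open>The strict and the weak comparison differ exactly when \<open>p\<close> is
  \<open>x k\<close>, which encodes the jump \<open>b\<close> there and continuity
  elsewhere.\<close>

lemma step_limits:
  "(step_test F b (x k) \<longlongrightarrow> F p + b * of_bool (x k < p)) (at_left p)"
  "(step_test F b (x k) \<longlongrightarrow> F p + b * of_bool (x k \<le> p)) (at_right p)"
proof -
  have Fp: "(F \<longlongrightarrow> F p) (at p within A)" for A
    using F_cont[of UNIV] by (simp add: continuous_on_eq_continuous_at isCont_def Lim_at_imp_Lim_at_within)
  have "eventually (\<lambda>t. t \<in> {min (x k) (p - 1)<..<p} \<and> (x k < p \<longrightarrow> x k < t)) (at_left p)"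
    by (rule eventually_at_leftI[of "if x k < p then x k else p - 1"]) (auto split: if_splits)
  then have "\<forall>\<^sub>F t in at_left p. F t + b * of_bool (x k < p) = step_test F b (x k) t"
    by eventually_elim (auto simp: step_test_def)
  then show "(step_test F b (x k) \<longlongrightarrow> F p + b * of_bool (x k < p)) (at_left p)"
    by (rule Lim_transform_eventually[rotated]) (intro tendsto_intros Fp)
  have "eventually (\<lambda>t. p < t \<and> (p < x k \<longrightarrow> t < x k)) (at_right p)"
    by (rule eventually_at_rightI[of _ "if p < x k then x k else p + 1"]) (auto split: if_splits)
  then have "\<forall>\<^sub>F t in at_right p. F t + b * of_bool (x k \<le> p) = step_test F b (x k) t"
    by eventually_elim (auto simp: step_test_def)
  then show "(step_test F b (x k) \<longlongrightarrow> F p + b * of_bool (x k \<le> p)) (at_right p)"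
    by (rule Lim_transform_eventually[rotated]) (intro tendsto_intros Fp)
qed

text \<open>At \<open>x k\<close> the jump is \<open>b\<close> and f' = 1; at every other point both
  the jump and f' vanish, whatever the strength.\<close>

lemma step_in_operator:
  assumes b: "\<beta> k = b"
  shows "(abs_L2 (\<lambda>t. complex_of_real (step_test F b (x k) t)), abs_L2 (\<lambda>t. - complex_of_real (\<phi>' t))) \<in> delta'_operator x \<beta>"
proof -
  have "\<exists>c l r. ((\<lambda>t. complex_of_real (\<phi> t)) \<longlongrightarrow> c) (at_left (x j)) \<and> ((\<lambda>t. complex_of_real (\<phi> t)) \<longlongrightarrow> c) (at_right (x j)) \<and>
      ((\<lambda>t. complex_of_real (step_test F b (x k) t)) \<longlongrightarrow> l) (at_left (x j)) \<and>
      ((\<lambda>t. complex_of_real (step_test F b (x k) t)) \<longlongrightarrow> r) (at_right (x j)) \<and> r - l = complex_of_real (\<beta> j) * c" for j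
  proof (intro exI conjI)
    have "(\<phi> \<longlongrightarrow> \<phi> (x j)) (at (x j) within A)" for A
      using c1_compact_cont[OF c1, of UNIV] by (simp add: continuous_on_eq_continuous_at isCont_def Lim_at_imp_Lim_at_within)
    then show "((\<lambda>t. complex_of_real (\<phi> t)) \<longlongrightarrow> complex_of_real (\<phi> (x j))) (at_left (x j))"
      "((\<lambda>t. complex_of_real (\<phi> t)) \<longlongrightarrow> complex_of_real (\<phi> (x j))) (at_right (x j))"
      by (auto intro: tendsto_intros)
    show "((\<lambda>t. complex_of_real (step_test F b (x k) t)) \<longlongrightarrow> complex_of_real (F (x j) + b * of_bool (x k < x j))) (at_left (x j))"
      "((\<lambda>t. complex_of_real (step_test F b (x k) t)) \<longlongrightarrow> complex_of_real (F (x j) + b * of_bool (x k \<le> x j))) (at_right (x j))"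
      by (intro tendsto_of_real step_limits)+
    have "x k = x j \<longleftrightarrow> k = j" using mono by (simp add: strict_mono_eq)
    then show "complex_of_real (F (x j) + b * of_bool (x k \<le> x j)) - complex_of_real (F (x j) + b * of_bool (x k < x j))
        = complex_of_real (\<beta> j) * complex_of_real (\<phi> (x j))"
      using b by (auto simp: \<phi>_at)
  qed
  note bc = this
  show ?thesis
    unfolding delta'_operator_def by (intro CollectI exI conjI, rule refl, rule step_W22, rule allI, rule bc)
qed

text \<open>Up to sign this is the form between two test elements. The smooth part is integrated by
  parts; the step contributes the value of \<psi> at \<open>x k\<close>.\<close>

lemma deriv_against_step:
  assumes \<psi>: "c1_compact S \<psi> \<psi>'"
  shows "(\<integral>t. \<psi>' t * step_test F b (x k) t \<partial>lborel) = - (\<integral>t. \<psi> t * \<phi> t \<partial>lborel) - b * \<psi> (x k)"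
proof -
  have \<psi>D: "\<And>t. (\<psi> has_real_derivative \<psi>' t) (at t)" "continuous_on UNIV \<psi>'" "\<And>t. S \<le> \<bar>t\<bar> \<Longrightarrow> \<psi> t = 0 \<and> \<psi>' t = 0"
    using \<psi> by (auto simp: c1_compact_def)
  note cont = \<psi>D(2) F_cont[of UNIV] c1_compact_cont[OF c1, of UNIV] c1_compact_cont[OF \<psi>, of UNIV]
  \<comment> \<open>\<open>F\<close> alone is not compactly supported, but the product is, so its
    derivative integrates to 0.\<close>
  have P: "c1_compact S (\<lambda>t. \<psi> t * F t) (\<lambda>t. \<psi>' t * F t + \<psi> t * \<phi> t)"
    unfolding c1_compact_def
  proof (intro conjI allI impI)
    show "0 \<le> S" using \<psi> by (simp add: c1_compact_def)
    show "((\<lambda>t. \<psi> t * F t) has_real_derivative \<psi>' t * F t + \<psi> t * \<phi> t) (at t)" for t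
      using DERIV_mult[OF \<psi>D(1)[of t] F(1)[of t]] by (simp add: algebra_simps)
    show "continuous_on UNIV (\<lambda>t. \<psi>' t * F t + \<psi> t * \<phi> t)" using cont by (intro continuous_intros)
  qed (use \<psi>D(3) in auto)
  have i: "integrable lborel (\<lambda>t. \<psi>' t * F t)" "integrable lborel (\<lambda>t. \<psi> t * \<phi> t)"
    using cont \<psi>D(3) by (auto intro!: integrable_compact_support[of _ S] continuous_intros)
  have i': "integrable lborel (\<lambda>t. b * (\<psi>' t * indicator {x k..} t))"
    using integrable_mult_indicator[OF _ c1_compact_integrable(3)[OF \<psi>], of "{x k..}"] by (simp add: mult.commute)
  have "(\<integral>t. \<psi>' t * step_test F b (x k) t \<partial>lborel) = (\<integral>t. \<psi>' t * F t + b * (\<psi>' t * indicator {x k..} t) \<partial>lborel)"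
    by (intro Bochner_Integration.integral_cong) (auto simp: step_test_def algebra_simps)
  also have "\<dots> = (\<integral>t. \<psi>' t * F t \<partial>lborel) + b * (\<integral>t. \<psi>' t * indicator {x k..} t \<partial>lborel)"
    using i i' by (subst Bochner_Integration.integral_add) auto
  also have "\<dots> = (\<integral>t. \<psi>' t * F t \<partial>lborel) - b * \<psi> (x k)"
    by (simp add: c1_compact_integral_tail[OF \<psi>])
  also have "(\<integral>t. \<psi>' t * F t \<partial>lborel) = - (\<integral>t. \<psi> t * \<phi> t \<partial>lborel)"
    using c1_compact_integral_deriv[OF P] i by simp
  finally show ?thesis .
qed

end

lemma c1_compact_product_bound:
  assumes "c1_compact R \<phi> \<phi>'" "c1_compact S \<psi> \<psi>'"
    and "(\<integral>t. (\<phi> t)\<^sup>2 \<partial>lborel) \<le> \<epsilon>" "(\<integral>t. (\<psi> t)\<^sup>2 \<partial>lborel) \<le> \<epsilon>"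
  shows "\<bar>\<integral>t. \<phi> t * \<psi> t \<partial>lborel\<bar> \<le> \<epsilon>"
proof -
  note i = c1_compact_integrable(2)[OF assms(1)] c1_compact_integrable(2)[OF assms(2)]
  have "integrable lborel (\<lambda>t. \<phi> t * \<psi> t)"
    using assms(1) c1_compact_cont[OF assms(1), of UNIV] c1_compact_cont[OF assms(2), of UNIV]
    by (intro integrable_compact_support[of _ R]) (auto simp: c1_compact_def intro!: continuous_intros)
  then have j: "integrable lborel (\<lambda>t. \<bar>\<phi> t * \<psi> t\<bar>)" by simp
  have "\<bar>\<integral>t. \<phi> t * \<psi> t \<partial>lborel\<bar> \<le> (\<integral>t. \<bar>\<phi> t * \<psi> t\<bar> \<partial>lborel)" by (rule integral_abs_bound)
  also have "\<dots> \<le> (\<integral>t. ((\<phi> t)\<^sup>2 + (\<psi> t)\<^sup>2) / 2 \<partial>lborel)"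
  proof (rule integral_mono[OF j])
    show "\<bar>\<phi> t * \<psi> t\<bar> \<le> ((\<phi> t)\<^sup>2 + (\<psi> t)\<^sup>2) / 2" for t
      using sum_squares_bound[of "\<bar>\<phi> t\<bar>" "\<bar>\<psi> t\<bar>"] by (simp add: abs_mult)
  qed (use i in auto)
  also have "\<dots> = ((\<integral>t. (\<phi> t)\<^sup>2 \<partial>lborel) + (\<integral>t. (\<psi> t)\<^sup>2 \<partial>lborel)) / 2" using i by simp
  also have "\<dots> \<le> \<epsilon>" using assms(3,4) by simp
  finally show ?thesis .
qed

text \<open>Cauchy-Schwarz bounds the square of the sum of |a k| by card K times the sum of squares,
  so the perturbation raises each diagonal entry by at most \<epsilon> card K.\<close>

lemma hermitian_form_neg:
  fixes m :: "'i \<Rightarrow> 'i \<Rightarrow> real" and a :: "'i \<Rightarrow> complex"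
  assumes K: "finite K" and m: "\<And>k l. k \<in> K \<Longrightarrow> l \<in> K \<Longrightarrow> \<bar>m k l\<bar> \<le> \<epsilon>"
    and neg: "\<And>k. k \<in> K \<Longrightarrow> \<epsilon> * card K + \<beta> k < 0" and a: "\<exists>k\<in>K. a k \<noteq> 0"
  shows "Re (\<Sum>k\<in>K. \<Sum>l\<in>K. a k * cnj (a l) * complex_of_real (m k l + (if k = l then \<beta> k else 0))) < 0"
proof -
  have \<epsilon>: "0 \<le> \<epsilon>" using m a by (metis abs_ge_zero order.trans)
  have "Re (\<Sum>k\<in>K. \<Sum>l\<in>K. a k * cnj (a l) * complex_of_real (m k l + (if k = l then \<beta> k else 0)))
     = (\<Sum>k\<in>K. \<Sum>l\<in>K. Re (a k * cnj (a l)) * m k l + (if k = l then \<beta> k * (cmod (a k))\<^sup>2 else 0))"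
    unfolding Re_sum cmod_power2 by (intro sum.cong refl) (auto simp: algebra_simps power2_eq_square)
  also have "\<dots> = (\<Sum>k\<in>K. \<Sum>l\<in>K. Re (a k * cnj (a l)) * m k l) + (\<Sum>k\<in>K. \<beta> k * (cmod (a k))\<^sup>2)"
    using K by (simp add: sum.distrib)
  also have "(\<Sum>k\<in>K. \<Sum>l\<in>K. Re (a k * cnj (a l)) * m k l) \<le> (\<Sum>k\<in>K. \<Sum>l\<in>K. cmod (a k) * cmod (a l) * \<epsilon>)"
  proof (intro sum_mono)
    fix k l assume "k \<in> K" "l \<in> K"
    have "Re (a k * cnj (a l)) * m k l \<le> \<bar>Re (a k * cnj (a l))\<bar> * \<bar>m k l\<bar>" by (metis abs_ge_self abs_mult)
    also have "\<dots> \<le> cmod (a k * cnj (a l)) * \<epsilon>"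
      using m[OF \<open>k \<in> K\<close> \<open>l \<in> K\<close>] by (intro mult_mono abs_Re_le_cmod) auto
    finally show "Re (a k * cnj (a l)) * m k l \<le> cmod (a k) * cmod (a l) * \<epsilon>" by (simp add: norm_mult)
  qed
  also have "\<dots> = \<epsilon> * (\<Sum>k\<in>K. cmod (a k))\<^sup>2"
    by (simp add: power2_eq_square sum_product sum_distrib_left sum_distrib_right mult_ac)
  also have "\<dots> \<le> \<epsilon> * ((\<Sum>k\<in>K. (cmod (a k))\<^sup>2) * card K)"
    using \<epsilon> by (intro mult_left_mono sum_squared_le_sum_of_squares)
  finally have "Re (\<Sum>k\<in>K. \<Sum>l\<in>K. a k * cnj (a l) * complex_of_real (m k l + (if k = l then \<beta> k else 0)))
     \<le> (\<Sum>k\<in>K. (\<epsilon> * card K + \<beta> k) * (cmod (a k))\<^sup>2)"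
    by (simp add: sum.distrib sum_distrib_left sum_distrib_right algebra_simps)
  also have "\<dots> < (\<Sum>k\<in>K. 0)"
  proof (rule sum_strict_mono_ex1[OF K])
    show "\<forall>k\<in>K. (\<epsilon> * card K + \<beta> k) * (cmod (a k))\<^sup>2 \<le> 0"
      using neg by (intro ballI mult_nonpos_nonneg) (auto intro: less_imp_le)
    show "\<exists>k\<in>K. (\<epsilon> * card K + \<beta> k) * (cmod (a k))\<^sup>2 < 0"
    proof -
      from a obtain k where k: "k \<in> K" "a k \<noteq> 0" by blast
      with neg show ?thesis by (intro bexI[OF _ k(1)] mult_neg_pos) auto
    qed
  qed
  finally show ?thesis by simp
qed

context point_sequence
begin

text \<open>Stated for any finite set of negative indices, so that it serves both the finite and the
  infinite case.\<close>

lemma card_le_negative_squares: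
  assumes E: "is_spectral_measure_of E (delta'_operator x \<beta>)" and K: "finite K" "\<And>k. k \<in> K \<Longrightarrow> \<beta> k < 0"
  shows "enat (card K) \<le> negative_squares E"
proof -
  \<comment> \<open>Dividing by card K + 1 makes \<epsilon> card K strictly smaller than every
    -beta_k; the inserted 1 covers empty \<open>K\<close>.\<close>
  define \<epsilon> where "\<epsilon> = Min (insert 1 ((\<lambda>k. - \<beta> k) ` K)) / (card K + 1)"
  have \<epsilon>: "0 < \<epsilon>" unfolding \<epsilon>_def using K by (intro divide_pos_pos) auto
  have neg: "\<epsilon> * card K + \<beta> k < 0" if "k \<in> K" for k
  proof -
    have "\<epsilon> * card K < \<epsilon> * (card K + 1)" using \<epsilon> by simp
    also have "\<dots> = Min (insert 1 ((\<lambda>k. - \<beta> k) ` K))" by (simp add: \<epsilon>_def)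
    also have "\<dots> \<le> - \<beta> k" using K that by (intro Min_le) auto
    finally show ?thesis by simp
  qed
  have "\<forall>k. \<exists>R \<phi> \<phi>' F. step_element x d k (\<beta> k) R \<phi> \<phi>' F \<and> (\<integral>t. (\<phi> t)\<^sup>2 \<partial>lborel) \<le> \<epsilon>"
  proof
    fix k
    obtain R \<phi> \<phi>' where 1: "c1_compact R \<phi> \<phi>'" "\<And>j. \<phi> (x j) = (if j = k then 1 else 0)"
      "integral\<^sup>L lborel \<phi> = - \<beta> k" "(\<integral>t. (\<phi> t)\<^sup>2 \<partial>lborel) \<le> \<epsilon>"
      using test_function_exists[OF \<epsilon>] by metis
    obtain F where 2: "\<And>t. (F has_real_derivative \<phi> t) (at t)" "\<And>t. t \<le> -R \<Longrightarrow> F t = 0"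
      "\<And>t. R \<le> t \<Longrightarrow> F t = integral\<^sup>L lborel \<phi>"
      using c1_compact_antiderivative[OF 1(1)] by metis
    have "step_element x d k (\<beta> k) R \<phi> \<phi>' F" by unfold_locales (use 1 2 in auto)
    then show "\<exists>R \<phi> \<phi>' F. step_element x d k (\<beta> k) R \<phi> \<phi>' F \<and> (\<integral>t. (\<phi> t)\<^sup>2 \<partial>lborel) \<le> \<epsilon>" using 1(4) by blast
  qed
  then obtain R \<phi> \<phi>' F where el: "\<And>k. step_element x d k (\<beta> k) (R k) (\<phi> k) (\<phi>' k) (F k)"
    and small: "\<And>k. (\<integral>t. (\<phi> k t)\<^sup>2 \<partial>lborel) \<le> \<epsilon>" by metis
  note c1 = step_element.c1[OF el]
  define G where "G k = abs_L2 (\<lambda>t. complex_of_real (step_test (F k) (\<beta> k) (x k) t))" for k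
  define u where "u k = abs_L2 (\<lambda>t. - complex_of_real (\<phi>' k t))" for k
  define m where "m k l = (\<integral>t. \<phi> k t * \<phi> l t \<partial>lborel)" for k l
  \<comment> \<open>The jump term is \<open>\<beta> l * \<phi> k (x l)\<close>; the prescribed point
    values make it diagonal.\<close>
  have inner: "cinner_L2 (u k) (G l) = complex_of_real (m k l + (if k = l then \<beta> k else 0))" for k l
  proof -
    have "cinner_L2 (u k) (G l) = (\<integral>t. complex_of_real (- (\<phi>' k t * step_test (F l) (\<beta> l) (x l) t)) \<partial>lborel)"
      unfolding u_def G_def
      by (subst cinner_abs_L2)
        (auto intro!: sq_integrable_uminus step_element.deriv_sq_integrable[OF el] step_element.step_sq_integrable[OF el])
    also have "\<dots> = complex_of_real (- (\<integral>t. \<phi>' k t * step_test (F l) (\<beta> l) (x l) t \<partial>lborel))"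
      by (simp only: integral_complex_of_real Bochner_Integration.integral_minus)
    also have "\<dots> = complex_of_real (m k l + \<beta> l * \<phi> k (x l))"
      unfolding step_element.deriv_against_step[OF el c1] m_def by simp
    finally show ?thesis using step_element.\<phi>_at[OF el, of k l] by simp
  qed
  show ?thesis
  proof (rule negative_squares_ge[OF E K(1)])
    show "(G k, u k) \<in> delta'_operator x \<beta>" for k
      unfolding G_def u_def by (rule step_element.step_in_operator[OF el refl])
    fix a :: "int \<Rightarrow> complex" assume a: "\<exists>k\<in>K. a k \<noteq> 0"
    have "cinner_L2 (\<Sum>k\<in>K. scaleC_L2 (a k) (u k)) (\<Sum>k\<in>K. scaleC_L2 (a k) (G k))
      = (\<Sum>k\<in>K. \<Sum>l\<in>K. a k * cnj (a l) * complex_of_real (m k l + (if k = l then \<beta> k else 0)))"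
      by (subst cinner_L2_sum_left, simp only: cinner_L2_sum_right cinner_L2_scale_left cinner_L2_scale_right inner)
        (simp only: mult_ac)
    moreover have "\<bar>m k l\<bar> \<le> \<epsilon>" for k l
      unfolding m_def by (rule c1_compact_product_bound[OF c1 c1 small small])
    ultimately show "Re (cinner_L2 (\<Sum>k\<in>K. scaleC_L2 (a k) (u k)) (\<Sum>k\<in>K. scaleC_L2 (a k) (G k))) < 0"
      using hermitian_form_neg[OF K(1), of m \<epsilon> \<beta> a] neg a by simp
  qed
qed

end

section \<open>The number of negative squares\<close>

theorem theorem4p1:
  fixes x \<beta> :: "int \<Rightarrow> real"
    and E :: "real set \<Rightarrow> L2 \<Rightarrow> L2"
  assumes "strict_mono x"
    and "0 < (INF k. x (k + 1) - x k)"
    and "bdd_above (range (\<lambda>k. x (k + 1) - x k))"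
    and "is_spectral_measure_of E (delta'_operator x \<beta>)"
  shows "negative_squares E = num_negative \<beta>"
proof -
  let ?d = "INF k. x (k + 1) - x k"
  \<comment> \<open>Over the reals the infimum is a lower bound only for a set that is bounded
    below.\<close>
  have "bdd_below (range (\<lambda>k. x (k + 1) - x k))"
    using assms(1) by (intro bdd_belowI[of _ 0]) (auto simp: strict_mono_less_eq)
  then interpret point_sequence x ?d
    by unfold_locales (use assms(1,2) in \<open>auto intro: cINF_lower\<close>)
  note lower = card_le_negative_squares[OF assms(4)]
  show ?thesis
  proof (cases "finite {k. \<beta> k < 0}")
    case True
    then show ?thesis
      using negative_squares_le_card[OF assms(4) True] lower[OF True]
      by (simp add: num_negative_def ecard_def)
  next
    case False
    have "enat n \<le> negative_squares E" for n
    proof -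
      obtain K where "K \<subseteq> {k. \<beta> k < 0}" "finite K" "card K = n"
        using infinite_arbitrarily_large[OF False] by blast
      then show ?thesis using lower[of K] by auto
    qed
    then have "negative_squares E = \<infinity>" by (metis enat_ord_simps(1) not_enat_eq not_less_eq_eq order.refl)
    then show ?thesis using False by (simp add: num_negative_def ecard_def)
  qed
qed

end
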